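(* Let $G$ be a connected 4-regular graph. Let $v$ and $w$ be adjacent vertices of $G$ which have exactly one common neighbour. Then \[ c_2^{(2)}(G - v) = c_2^{(2)}(G - w). \]
   Context: For a graph $H$, $H-v$ denotes the graph obtained by deleting the vertex $v$ and all edges incident to it. For a connected graph $H$ with at least $3$ vertices, assign a variable $\alpha_e$ to each edge $e$ and define $\Psi_H=\sum_{T}\prod_{e\notin T}\alpha_e$, the sum over all spanning trees $T$ of $H$. For a prime $p$, let $[\Psi_H]_p$ be the number of zeros of $\Psi_H$ in $\mathbb{F}_p^{|E(H)|}$; it is divisible by $p^2$, and $c_2^{(p)}(H)\equiv [\Psi_H]_p/p^2 \pmod p$. *)

theory Defs
  imports Complex_Main "HOL-Library.FuncSet" "HOL-Number_Theory.Cong"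
begin

text \<open>
  Finite undirected graphs in which parallel edges are allowed and self-loops are not.
  Edges carry their own identity (type 'e), so that every edge has its own variable.
\<close>

record ('v, 'e) mgraph =
  verts :: "'v set"
  edges :: "'e set"
  ends  :: "'e \<Rightarrow> 'v set"

definition wf_mgraph :: "('v, 'e) mgraph \<Rightarrow> bool" where
  "wf_mgraph G \<longleftrightarrow>
     finite (verts G) \<and> finite (edges G) \<and>
     (\<forall>e\<in>edges G. ends G e \<subseteq> verts G \<and> card (ends G e) = 2)"

definition adjacent :: "('v, 'e) mgraph \<Rightarrow> 'v \<Rightarrow> 'v \<Rightarrow> bool" where
  "adjacent G x y \<longleftrightarrow> (\<exists>e\<in>edges G. ends G e = {x, y})"

definition neighbours :: "('v, 'e) mgraph \<Rightarrow> 'v \<Rightarrow> 'v set" where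
  "neighbours G x = {y \<in> verts G. adjacent G x y}"

definition degree :: "('v, 'e) mgraph \<Rightarrow> 'v \<Rightarrow> nat" where
  "degree G x = card {e \<in> edges G. x \<in> ends G e}"

definition regular :: "nat \<Rightarrow> ('v, 'e) mgraph \<Rightarrow> bool" where
  "regular k G \<longleftrightarrow> (\<forall>x\<in>verts G. degree G x = k)"

definition connected_graph :: "('v, 'e) mgraph \<Rightarrow> bool" where
  "connected_graph G \<longleftrightarrow>
     verts G \<noteq> {} \<and> (\<forall>x\<in>verts G. \<forall>y\<in>verts G. (adjacent G)\<^sup>*\<^sup>* x y)"

definition delete_vertex :: "('v, 'e) mgraph \<Rightarrow> 'v \<Rightarrow> ('v, 'e) mgraph" where
  "delete_vertex G x =
     G\<lparr>verts := verts G - {x}, edges := {e \<in> edges G. x \<notin> ends G e}\<rparr>"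

text \<open>
  A cycle is given by its edges \<open>es ! 0, es ! 1, \<dots>\<close> and vertices \<open>xs ! 0, xs ! 1, \<dots>\<close> in cyclic
  order; two parallel edges form a cycle of length 2.
\<close>

definition is_cycle :: "('v, 'e) mgraph \<Rightarrow> 'v list \<Rightarrow> 'e list \<Rightarrow> bool" where
  "is_cycle G xs es \<longleftrightarrow>
     es \<noteq> [] \<and> length xs = length es \<and> distinct xs \<and> distinct es \<and>
     set xs \<subseteq> verts G \<and> set es \<subseteq> edges G \<and>
     (\<forall>i<length es. ends G (es ! i) = {xs ! i, xs ! (Suc i mod length es)})"

definition is_tree :: "('v, 'e) mgraph \<Rightarrow> bool" where
  "is_tree G \<longleftrightarrow> connected_graph G \<and> (\<nexists>xs es. is_cycle G xs es)"

definition spanning_tree :: "('v, 'e) mgraph \<Rightarrow> 'e set \<Rightarrow> bool" where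
  "spanning_tree G T \<longleftrightarrow> T \<subseteq> edges G \<and> is_tree (G\<lparr>edges := T\<rparr>)"

text \<open>The polynomial \<open>\<Psi>\<^sub>G\<close>, as a function of the values of the edge variables.\<close>

definition Psi :: "('v, 'e) mgraph \<Rightarrow> ('e \<Rightarrow> 'a::comm_ring_1) \<Rightarrow> 'a" where
  "Psi G \<alpha> = (\<Sum>T | spanning_tree G T. \<Prod>e\<in>edges G - T. \<alpha> e)"

text \<open>
  The field with \<open>p\<close> elements is represented by the residues \<open>0, \<dots>, p - 1\<close>; extensional functions
  make each point of the affine space over the edge set count once.
\<close>

definition point_count :: "nat \<Rightarrow> ('v, 'e) mgraph \<Rightarrow> nat" where
  "point_count p G =
     card {\<alpha> \<in> edges G \<rightarrow>\<^sub>E {0..<int p}. [Psi G \<alpha> = 0] (mod int p)}"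

text \<open>
  The \<open>c\<^sub>2\<close>-invariant at the prime \<open>p\<close>, as its representative in \<open>{0..<p}\<close>. The division is exact
  for connected graphs with at least 3 vertices.
\<close>

definition c2 :: "nat \<Rightarrow> ('v, 'e) mgraph \<Rightarrow> nat" where
  "c2 p G = (point_count p G div p\<^sup>2) mod p"

end

theory Submission
  imports Defs "HOL-Library.Z2"
begin

text \<open>
  Modulo 2, a point \<open>\<alpha>\<close> is the set \<open>Z\<close> of edges where it vanishes, and \<open>\<Psi>\<close> at \<open>\<alpha>\<close> is the parity of the
  number of spanning trees that contain \<open>Z\<close>. Let \<open>u\<close> be a 3-valent vertex of \<open>H\<close> with neighbours
  \<open>x\<close>, \<open>y\<close>, \<open>z\<close> and let \<open>K = H - u\<close>. The Dodgson identity between the forest polynomials of \<open>K\<close>, proved here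
  with Kirchhoff potentials over the field with two elements, shows that \<open>c\<^sub>2\<close> of \<open>H\<close> is the parity of the number of
  partitions of the edges of \<open>K\<close> into a spanning tree \<open>T\<close> and a spanning forest \<open>F\<close> with two components
  such that \<open>x\<close>, \<open>y\<close>, \<open>z\<close> do not all lie in the same component of \<open>F\<close>.

  If \<open>v\<close> and \<open>w\<close> are joined by one edge, then \<open>K = G - v - w\<close> serves for both \<open>G - v\<close> and \<open>G - w\<close>. The common
  neighbour \<open>a\<close> has at most two edges in \<open>K\<close>; removing it, with remaining neighbours \<open>y\<close>, \<open>y'\<close>, the two
  counts differ by the sum, over the partitions for which \<open>F\<close> separates \<open>y\<close> from \<open>y'\<close>, of the numbers of pairs
  among \<open>{b\<^sub>1, b\<^sub>2}\<close>, \<open>{d\<^sub>1, d\<^sub>2}\<close> (the other neighbours of \<open>w\<close> and of \<open>v\<close>) that \<open>F\<close> separates. As all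
  degrees of \<open>G\<close> are even, this number has the parity of one plus the number of edges between the components of \<open>F\<close>, and an edge
  exchange argument shows that the sum is even. If \<open>v\<close> and \<open>w\<close> are joined by several edges, both invariants vanish.
\<close>

section \<open>Connectivity through potentials\<close>

text \<open>The elements of \<open>R\<close> are hyperedges, so that contracting a star replaces it by one of them.\<close>

declare add_bit_eq_xor [simp del] mult_bit_eq_and [simp del]

text \<open>On a pair this is the coboundary \<open>\<psi> a + \<psi> b\<close>, linear in
  \<open>\<psi>\<close>. On larger hyperedges it only records that \<open>\<psi>\<close> is not
  constant, so the linearity lemmas ask for pairs; \<open>{a, b}\<close> with \<open>a = b\<close>
  is allowed.\<close>

definition dif :: "('v \<Rightarrow> bit) \<Rightarrow> 'v set \<Rightarrow> bit" where
  "dif \<psi> r = of_bool (\<exists>a\<in>r. \<exists>b\<in>r. \<psi> a \<noteq> \<psi> b)"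

text \<open>Connectivity in dual form: a 0/1 potential constant on every hyperedge is the indicator
  of a union of components, so with one component only the potentials constant on \<open>V\<close>
  remain. This opens connectivity to linear algebra over \<open>bit\<close>.\<close>

definition conn :: "'v set \<Rightarrow> 'v set set \<Rightarrow> bool" where
  "conn V R \<longleftrightarrow> (\<forall>\<psi>. (\<forall>r\<in>R. dif \<psi> r = 0) \<longrightarrow> (\<forall>a\<in>V. \<forall>b\<in>V. \<psi> a = \<psi> b))"

lemma bit_add_self [simp]: "(x::bit) + x = 0"
  by (cases x) simp_all

lemma bit_add_self_left [simp]: "(x::bit) + (x + y) = y"
  by (cases x) (simp_all flip: add.assoc)

lemma bit_add_eq_0_iff: "(x::bit) + y = 0 \<longleftrightarrow> x = y"
  by (cases x; cases y) simp_all

lemma dif_eq_0_iff: "dif \<psi> r = 0 \<longleftrightarrow> (\<forall>a\<in>r. \<forall>b\<in>r. \<psi> a = \<psi> b)"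
  unfolding dif_def by auto

lemma dif_pair [simp]: "dif \<psi> {a, b} = \<psi> a + \<psi> b"
  unfolding dif_def by (cases "\<psi> a"; cases "\<psi> b") auto

lemma dif_singleton [simp]: "dif \<psi> {a} = 0"
  by (simp add: dif_def)

lemma dif_add:
  assumes "\<exists>a b. r = {a, b}"
  shows "dif (\<lambda>z. \<psi> z + \<phi> z) r = dif \<psi> r + dif \<phi> r"
  using assms by (auto simp: ac_simps)

lemma dif_sum:
  assumes "\<exists>a b. r = {a, b}"
  shows "dif (\<lambda>z. \<Sum>i\<in>I. c i * \<phi> i z) r = (\<Sum>i\<in>I. c i * dif (\<phi> i) r)"
  using assms by (auto simp: sum.distrib distrib_left)

lemma dif_cong: "(\<And>z. z \<in> r \<Longrightarrow> \<psi> z = \<phi> z) \<Longrightarrow> dif \<psi> r = dif \<phi> r"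
  unfolding dif_def by auto

lemma connD: "conn V R \<Longrightarrow> (\<And>r. r \<in> R \<Longrightarrow> dif \<psi> r = 0) \<Longrightarrow> a \<in> V \<Longrightarrow> b \<in> V \<Longrightarrow> \<psi> a = \<psi> b"
  unfolding conn_def by blast

lemma conn_mono: "conn V R \<Longrightarrow> R \<subseteq> R' \<Longrightarrow> conn V R'"
  unfolding conn_def by blast

lemma conn_insert_singleton [simp]: "conn V (insert {x} R) = conn V R"
  unfolding conn_def by simp

lemma conn_insert_triple: "conn V (insert {x, y, z} R) = conn V (insert {x, y} (insert {x, z} R))"
proof -
  have "dif \<psi> {x, y, z} = 0 \<longleftrightarrow> dif \<psi> {x, y} = 0 \<and> dif \<psi> {x, z} = 0" for \<psi> :: "'a \<Rightarrow> bit"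
    by (cases "\<psi> x"; cases "\<psi> y"; cases "\<psi> z") (simp_all add: dif_eq_0_iff del: dif_pair)
  then show ?thesis unfolding conn_def by simp
qed

text \<open>If one extra edge makes \<open>R\<close> connected, then \<open>R\<close> has exactly two components, and \<open>\<chi>\<close> is the
  indicator of one of them.\<close>

lemma two_components:
  assumes "conn V (insert r R)" and "\<not> conn V R" and r: "\<exists>a b. r = {a, b}"
    and R: "\<And>s. s \<in> R \<Longrightarrow> \<exists>a b. s = {a, b}"
  shows "\<exists>\<chi>. (\<forall>s\<in>R. dif \<chi> s = 0) \<and> dif \<chi> r = 1 \<and>
    (\<forall>a\<in>V. \<forall>b\<in>V. conn V (insert {a, b} R) \<longleftrightarrow> \<chi> a \<noteq> \<chi> b)"
proof -
  obtain \<chi> a0 b0 where \<chi>: "\<forall>s\<in>R. dif \<chi> s = 0" and ab0: "a0 \<in> V" "b0 \<in> V" "\<chi> a0 \<noteq> \<chi> b0"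
    using assms(2) unfolding conn_def by blast
  have one: "dif \<chi> r = 1"
  proof (rule ccontr)
    assume "dif \<chi> r \<noteq> 1"
    then have "\<forall>s\<in>insert r R. dif \<chi> s = 0" using \<chi> by simp
    then show False using assms(1) ab0 unfolding conn_def by blast
  qed
  have "conn V (insert {a, b} R) \<longleftrightarrow> \<chi> a \<noteq> \<chi> b" if ab: "a \<in> V" "b \<in> V" for a b
  proof
    assume c: "conn V (insert {a, b} R)"
    show "\<chi> a \<noteq> \<chi> b"
    proof
      assume "\<chi> a = \<chi> b"
      then have "\<forall>s\<in>insert {a, b} R. dif \<chi> s = 0" using \<chi> by simp
      then show False using c ab0 unfolding conn_def by blast
    qed
  next
    assume ne: "\<chi> a \<noteq> \<chi> b"
    show "conn V (insert {a, b} R)"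
      unfolding conn_def
    proof (intro allI impI)
      fix \<psi> :: "'a \<Rightarrow> bit" assume \<psi>: "\<forall>s\<in>insert {a, b} R. dif \<psi> s = 0"
      show "\<forall>a\<in>V. \<forall>b\<in>V. \<psi> a = \<psi> b"
      proof (cases "dif \<psi> r = 0")
        case True
        then have "\<forall>s\<in>insert r R. dif \<psi> s = 0" using \<psi> by simp
        then show ?thesis using assms(1) unfolding conn_def by blast
      next
        case False
        \<comment> \<open>Both potentials have difference 1 across \<open>r\<close>, so their sum
          has none and is constant on \<open>V\<close>; at \<open>a\<close> and \<open>b\<close>
          this contradicts \<open>\<chi> a \<noteq> \<chi> b\<close>.\<close>
        have "dif (\<lambda>z. \<psi> z + \<chi> z) s = 0" if "s \<in> insert r R" for s
        proof (cases "s = r")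
          case True
          then show ?thesis using False one by (simp add: dif_add[OF r])
        next
          case False
          then have "s \<in> R" using that by simp
          then show ?thesis using \<psi> \<chi> by (simp add: dif_add[OF R])
        qed
        then have "\<psi> a + \<chi> a = \<psi> b + \<chi> b"
          using connD[OF assms(1), of "\<lambda>z. \<psi> z + \<chi> z"] ab by blast
        moreover have "\<psi> a = \<psi> b" using \<psi> by (simp add: bit_add_eq_0_iff)
        ultimately show ?thesis using ne by simp
      qed
    qed
  qed
  then show ?thesis using \<chi> one by blast
qed

text \<open>Up to the constant \<open>\<chi> x\<close>, the potential used here is the component
  indicator \<open>\<chi>\<close>, whose difference along \<open>s\<close> says whether
  \<open>s\<close> joins the two components.\<close>

lemma dif_component:
  assumes "conn V (insert r R)" and "\<not> conn V R" and r: "\<exists>a b. r = {a, b}"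
    and R: "\<And>s. s \<in> R \<Longrightarrow> \<exists>a b. s = {a, b}" and "x \<in> V" and s: "s \<subseteq> V" "\<exists>a b. s = {a, b}"
  shows "dif (\<lambda>z. of_bool (conn V (insert {x, z} R))) s = of_bool (conn V (insert s R))"
proof -
  obtain \<chi> :: "'a \<Rightarrow> bit" where \<chi>: "\<And>a b. a \<in> V \<Longrightarrow> b \<in> V \<Longrightarrow> conn V (insert {a, b} R) \<longleftrightarrow> \<chi> a \<noteq> \<chi> b"
    using two_components[OF assms(1-4)] by meson
  obtain a b where ab: "s = {a, b}" using s by blast
  then have V: "a \<in> V" "b \<in> V" using s by auto
  show ?thesis
    unfolding ab dif_pair \<chi>[OF V] \<chi>[OF \<open>x \<in> V\<close> V(1)] \<chi>[OF \<open>x \<in> V\<close> V(2)]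
    by (cases "\<chi> x"; cases "\<chi> a"; cases "\<chi> b") simp_all
qed

text \<open>Minimality makes \<open>R\<close> act as a spanning tree. An element \<open>r\<close>
  can be replaced by \<open>{x, y}\<close> exactly when it lies on the tree path from
  \<open>x\<close> to \<open>y\<close>, so the differences of \<open>\<psi>\<close> telescope along
  that path. The path itself is never built: \<open>\<psi>\<close> is expanded in the fundamental
  cuts of the tree.\<close>

lemma path_sum:
  fixes \<psi> :: "'v \<Rightarrow> bit"
  assumes "finite R" and pair: "\<And>r. r \<in> R \<Longrightarrow> \<exists>a b. r = {a, b}" and "conn V R"
    and min: "\<And>r. r \<in> R \<Longrightarrow> \<not> conn V (R - {r})" and xy: "x \<in> V" "y \<in> V"
  shows "(\<Sum>r\<in>R. of_bool (conn V (insert {x, y} (R - {r}))) * dif \<psi> r) = \<psi> x + \<psi> y"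
proof -
  \<comment> \<open>\<open>\<chi>\<close> is the fundamental cut of \<open>r\<close>: the indicator
    of one side of \<open>R - {r}\<close>, with a difference only across \<open>r\<close>.\<close>
  have "\<exists>\<chi>. (\<forall>s\<in>R. dif \<chi> s = of_bool (s = r)) \<and>
      (conn V (insert {x, y} (R - {r})) \<longleftrightarrow> \<chi> x \<noteq> \<chi> y)" if r: "r \<in> R" for r
  proof -
    have "conn V (insert r (R - {r}))" using r \<open>conn V R\<close> by (simp add: insert_absorb)
    then have "\<exists>\<chi>. (\<forall>s\<in>R - {r}. dif \<chi> s = 0) \<and> dif \<chi> r = 1 \<and>
      (\<forall>a\<in>V. \<forall>b\<in>V. conn V (insert {a, b} (R - {r})) \<longleftrightarrow> \<chi> a \<noteq> \<chi> b)"
      using min[OF r] pair r by (intro two_components) auto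
    then obtain \<chi> where \<chi>: "\<forall>s\<in>R - {r}. dif \<chi> s = 0" "dif \<chi> r = 1"
      "\<forall>a\<in>V. \<forall>b\<in>V. conn V (insert {a, b} (R - {r})) \<longleftrightarrow> \<chi> a \<noteq> \<chi> b"
      by blast
    have "dif \<chi> s = of_bool (s = r)" if "s \<in> R" for s using \<chi>(1,2) that by (cases "s = r") auto
    then show ?thesis using \<chi>(3) xy by blast
  qed
  then obtain \<chi> where \<chi>: "\<And>r s. r \<in> R \<Longrightarrow> s \<in> R \<Longrightarrow> dif (\<chi> r) s = of_bool (s = r)"
    "\<And>r. r \<in> R \<Longrightarrow> conn V (insert {x, y} (R - {r})) \<longleftrightarrow> \<chi> r x \<noteq> \<chi> r y"
    by metis
  \<comment> \<open>Subtracting from \<open>\<psi>\<close> its expansion in fundamental cuts leaves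
    a potential without differences on \<open>R\<close>, hence a constant.\<close>
  define \<phi> where "\<phi> = (\<lambda>z. \<psi> z + (\<Sum>r\<in>R. dif \<psi> r * \<chi> r z))"
  have "dif \<phi> s = 0" if s: "s \<in> R" for s
  proof -
    have "dif \<phi> s = dif \<psi> s + (\<Sum>r\<in>R. dif \<psi> r * dif (\<chi> r) s)"
      unfolding \<phi>_def by (simp add: dif_add[OF pair[OF s]] dif_sum[OF pair[OF s]])
    also have "(\<Sum>r\<in>R. dif \<psi> r * dif (\<chi> r) s) = (\<Sum>r\<in>R. if s = r then dif \<psi> r else 0)"
      by (rule sum.cong) (auto simp: \<chi> s)
    also have "\<dots> = dif \<psi> s" using s \<open>finite R\<close> by simp
    finally show ?thesis by simp
  qed
  then have "\<phi> x = \<phi> y" using connD[OF \<open>conn V R\<close>] xy by blast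
  then have "\<psi> x + \<psi> y = (\<Sum>r\<in>R. dif \<psi> r * \<chi> r x) + (\<Sum>r\<in>R. dif \<psi> r * \<chi> r y)"
    unfolding \<phi>_def
    by (cases "\<psi> x"; cases "\<psi> y"; cases "\<Sum>r\<in>R. dif \<psi> r * \<chi> r x"; cases "\<Sum>r\<in>R. dif \<psi> r * \<chi> r y") auto
  also have "\<dots> = (\<Sum>r\<in>R. of_bool (conn V (insert {x, y} (R - {r}))) * dif \<psi> r)"
    unfolding sum.distrib[symmetric]
  proof (rule sum.cong)
    fix r assume "r \<in> R"
    then show "dif \<psi> r * \<chi> r x + dif \<psi> r * \<chi> r y =
        of_bool (conn V (insert {x, y} (R - {r}))) * dif \<psi> r"
      using \<chi>(2)[of r] by (cases "\<chi> r x"; cases "\<chi> r y") auto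
  qed simp
  finally show ?thesis by simp
qed

section \<open>Edge counts of connected and of minimal connected sets\<close>

text \<open>Send a set of vertices other than \<open>x\<close> to the edges leaving it. In a
  connected graph this cut determines the set, so \<open>2 ^ (card V - 1)\<close> is at most
  \<open>2 ^ card R\<close>.\<close>

lemma conn_card_le:
  assumes "finite V" "V \<noteq> {}" "finite R" and pair: "\<And>r. r \<in> R \<Longrightarrow> \<exists>a b. r = {a, b}" and "conn V R"
  shows "card V \<le> card R + 1"
proof -
  obtain x where x: "x \<in> V" using assms by blast
  define h :: "'a set \<Rightarrow> 'a set set" where "h S = {r\<in>R. dif (\<lambda>z. of_bool (z \<in> S)) r = 1}" for S
  have "inj_on h (Pow (V - {x}))"
  proof (rule inj_onI)
    fix S S' assume S: "S \<in> Pow (V - {x})" "S' \<in> Pow (V - {x})" and eq: "h S = h S'"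
    let ?i = "\<lambda>S z. of_bool (z \<in> S) :: bit"
    have "dif (\<lambda>z. ?i S z + ?i S' z) r = 0" if r: "r \<in> R" for r
    proof -
      have "dif (?i S) r = 1 \<longleftrightarrow> dif (?i S') r = 1" using eq r unfolding h_def by blast
      then show ?thesis unfolding dif_add[OF pair[OF r]]
        by (cases "dif (?i S) r"; cases "dif (?i S') r") auto
    qed
    then have eq0: "?i S z + ?i S' z = ?i S x + ?i S' x" if "z \<in> V" for z
      using connD[OF \<open>conn V R\<close>, of "\<lambda>z. ?i S z + ?i S' z"] x that by blast
    then have "z \<in> S \<longleftrightarrow> z \<in> S'" if "z \<in> V" for z
    proof -
      have "x \<notin> S" "x \<notin> S'" using S by auto
      then show ?thesis using eq0[OF that] by (cases "z \<in> S"; cases "z \<in> S'") simp_all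
    qed
    then show "S = S'" using S by blast
  qed
  moreover have "h ` Pow (V - {x}) \<subseteq> Pow R" unfolding h_def by blast
  ultimately have "card (Pow (V - {x})) \<le> card (Pow R)"
    using \<open>finite R\<close> by (intro card_inj_on_le[of h]) auto
  then have "card (V - {x}) \<le> card R"
    using assms by (simp add: card_Pow)
  then show ?thesis using x \<open>finite V\<close> by simp
qed

text \<open>The injection in the other direction: a set \<open>Q\<close> of edges goes to the vertex
  set, normalised to omit \<open>x\<close>, whose cut is \<open>Q\<close>. It is obtained by adding
  the fundamental cuts of the members of \<open>Q\<close>.\<close>

lemma card_le_of_minimal_conn:
  assumes "finite V" "V \<noteq> {}" "finite R" and pair: "\<And>r. r \<in> R \<Longrightarrow> r \<subseteq> V \<and> (\<exists>a b. r = {a, b})"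
    and "conn V R" and min: "\<And>r. r \<in> R \<Longrightarrow> \<not> conn V (R - {r})"
  shows "card R + 1 \<le> card V"
proof -
  obtain x where x: "x \<in> V" using assms by blast
  have pair': "\<exists>a b. r = {a, b}" if "r \<in> R" for r using pair that by blast
  have "\<exists>\<chi>. (\<forall>s\<in>R. dif \<chi> s = of_bool (s = r))" if r: "r \<in> R" for r
  proof -
    have "conn V (insert r (R - {r}))" using r \<open>conn V R\<close> by (simp add: insert_absorb)
    then have "\<exists>\<chi>. (\<forall>s\<in>R - {r}. dif \<chi> s = 0) \<and> dif \<chi> r = 1 \<and>
      (\<forall>a\<in>V. \<forall>b\<in>V. conn V (insert {a, b} (R - {r})) \<longleftrightarrow> \<chi> a \<noteq> \<chi> b)"
      using min[OF r] pair r by (intro two_components) auto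
    then obtain \<chi> where \<chi>: "\<forall>s\<in>R - {r}. dif \<chi> s = 0" "dif \<chi> r = 1"
      by blast
    have "dif \<chi> s = of_bool (s = r)" if "s \<in> R" for s using \<chi>(1,2) that by (cases "s = r") auto
    then show ?thesis by blast
  qed
  then obtain \<chi> where \<chi>: "\<And>r s. r \<in> R \<Longrightarrow> s \<in> R \<Longrightarrow> dif (\<chi> r) s = of_bool (s = r)"
    by metis
  define g where "g Q = {z\<in>V. (\<Sum>r\<in>Q. \<chi> r z) \<noteq> (\<Sum>r\<in>Q. \<chi> r x)}" for Q
  have *: "dif (\<lambda>z. of_bool (z \<in> g Q)) s = of_bool (s \<in> Q)" if Q: "Q \<subseteq> R" and s: "s \<in> R" for Q s
  proof -
    have fQ: "finite Q" using Q \<open>finite R\<close> finite_subset by blast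
    obtain a b where ab: "s = {a, b}" "a \<in> V" "b \<in> V" using pair[OF s] by auto
    have "dif (\<lambda>z. of_bool (z \<in> g Q)) s = dif (\<lambda>z. \<Sum>r\<in>Q. 1 * \<chi> r z) s"
      unfolding ab dif_pair using ab(2,3)
      by (cases "\<Sum>r\<in>Q. \<chi> r a"; cases "\<Sum>r\<in>Q. \<chi> r b"; cases "\<Sum>r\<in>Q. \<chi> r x") (auto simp: g_def)
    also have "\<dots> = (\<Sum>r\<in>Q. 1 * dif (\<chi> r) s)" by (rule dif_sum[OF pair'[OF s]])
    also have "\<dots> = (\<Sum>r\<in>Q. if s = r then 1 else 0)"
      using Q s by (intro sum.cong) (auto simp: \<chi> subset_eq)
    also have "\<dots> = of_bool (s \<in> Q)" using fQ by simp
    finally show ?thesis .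
  qed
  have "inj_on g (Pow R)"
  proof (rule inj_onI)
    fix Q Q' assume Q: "Q \<in> Pow R" "Q' \<in> Pow R" and "g Q = g Q'"
    then have "s \<in> Q \<longleftrightarrow> s \<in> Q'" if "s \<in> R" for s
      using *[of Q s] *[of Q' s] that by (cases "s \<in> Q"; cases "s \<in> Q'") auto
    then show "Q = Q'" using Q by blast
  qed
  moreover have "g ` Pow R \<subseteq> Pow (V - {x})" unfolding g_def by auto
  ultimately have "card (Pow R) \<le> card (Pow (V - {x}))"
    using \<open>finite V\<close> by (intro card_inj_on_le[of g]) auto
  then have "card R \<le> card (V - {x})"
    using assms by (simp add: card_Pow)
  moreover have "card (V - {x}) + 1 = card V" using x \<open>finite V\<close>
    by (metis Suc_eq_plus1 card.remove)
  ultimately show ?thesis by linarith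
qed

section \<open>Forests and the Dodgson identity\<close>

locale incidence =
  fixes V :: "'v set" and E :: "'e set" and en :: "'e \<Rightarrow> 'v set"
  assumes finV: "finite V" and neV: "V \<noteq> {}" and finE: "finite E"
    and enV: "e \<in> E \<Longrightarrow> en e \<subseteq> V" and en2: "e \<in> E \<Longrightarrow> card (en e) = 2"
begin

text \<open>The extra hyperedges \<open>X\<close> stand for identifications of vertices. If
  \<open>D\<close> has \<open>card V - 2\<close> elements, \<open>cb {{x, y}} D\<close> says that
  \<open>D\<close> is a forest with two components which separate \<open>x\<close> from
  \<open>y\<close>.\<close>

definition cb :: "'v set set \<Rightarrow> 'e set \<Rightarrow> bit" where
  "cb X D = of_bool (conn V (X \<union> en ` D))"

text \<open>The size \<open>card V - k\<close>, written additively, is that of a spanning forest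
  with \<open>k\<close> components; a \<open>D\<close> of this size that becomes connected after
  adding \<open>k - 1\<close> pairs is such a forest.\<close>

definition fam :: "'e set \<Rightarrow> nat \<Rightarrow> 'e set set" where
  "fam Z k = {D. Z \<subseteq> D \<and> D \<subseteq> E \<and> card D + k = card V}"

lemma fin_fam: "finite (fam Z k)"
  by (rule finite_subset[of _ "Pow E"]) (auto simp: fam_def finE)

lemma en_pair: "e \<in> E \<Longrightarrow> \<exists>a b. en e = {a, b}"
  using en2[of e] by (metis card_2_iff)

lemma cb_insert_singleton [simp]: "cb (insert {x} X) D = cb X D"
  by (simp add: cb_def)

lemma cb_insert_edge: "cb X (insert e D) = cb (insert (en e) X) D"
  by (simp add: cb_def)

lemma cb_eq_0:
  assumes "D \<subseteq> E" "finite X" "\<And>r. r \<in> X \<Longrightarrow> \<exists>a b. r = {a, b}" "card D + card X + 1 < card V"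
  shows "cb X D = 0"
proof -
  have fD: "finite D" using assms finE finite_subset by blast
  have "card (X \<union> en ` D) \<le> card X + card D"
    using card_Un_le[of X "en ` D"] card_image_le[OF fD, of en] by linarith
  then have "\<not> conn V (X \<union> en ` D)"
    using conn_card_le[of V "X \<union> en ` D"] finV neV fD assms en_pair by fastforce
  then show ?thesis by (simp add: cb_def)
qed

text \<open>The pair \<open>r\<close> witnesses that \<open>D\<close> and \<open>X\<close> leave
  only two components, so \<open>cb (insert {x, y} X) D\<close> says whether \<open>x\<close> and
  \<open>y\<close> lie in different ones, and such indicators are additive.\<close>

lemma cb_add_path:
  assumes "D \<subseteq> E" "finite X" "\<And>r. r \<in> X \<Longrightarrow> \<exists>a b. r = {a, b}" "card D + card X + 1 < card V"
    and "x \<in> V" "y \<in> V" "z \<in> V"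
    and "cb (insert r X) D = 1" "\<exists>a b. r = {a, b}"
  shows "cb (insert {x, y} X) D + cb (insert {x, z} X) D = cb (insert {y, z} X) D"
proof -
  have n: "\<not> conn V (X \<union> en ` D)" using cb_eq_0[OF assms(1-4)] by (simp add: cb_def)
  have c: "conn V (insert r (X \<union> en ` D))" using assms(8) by (simp add: cb_def split: if_splits)
  have "\<exists>a b. s = {a, b}" if "s \<in> X \<union> en ` D" for s using that assms(1,3) en_pair by blast
  moreover have "{y, z} \<subseteq> V" "\<exists>a b. {y, z} = {a, b}" using assms by blast+
  ultimately have "dif (\<lambda>u. of_bool (conn V (insert {x, u} (X \<union> en ` D)))) {y, z} =
      of_bool (conn V (insert {y, z} (X \<union> en ` D)))"
    by (intro dif_component[OF c n assms(9)]) (use \<open>x \<in> V\<close> in auto)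
  then show ?thesis by (simp add: cb_def)
qed

lemma dif_cb:
  assumes "D \<subseteq> E" "finite X" "\<And>r. r \<in> X \<Longrightarrow> \<exists>a b. r = {a, b}" "card D + card X + 1 < card V"
    and "x \<in> V" "e \<in> E" and "cb (insert r X) D = 1" "\<exists>a b. r = {a, b}"
  shows "dif (\<lambda>z. cb (insert {x, z} X) D) (en e) = cb (insert (en e) X) D"
proof -
  obtain a b where ab: "en e = {a, b}" using en_pair assms by blast
  then have "a \<in> V" "b \<in> V" using enV assms by auto
  then show ?thesis unfolding ab dif_pair using cb_add_path assms by blast
qed

text \<open>The pairs in \<open>X\<close> and the edges of \<open>D\<close> together form a spanning
  tree, so \<open>path_sum\<close> applies; the part of its sum that runs over \<open>X\<close> is
  moved to the right.\<close>

lemma edge_path_sum: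
  assumes D: "D \<subseteq> E" and X: "finite X" "\<And>r. r \<in> X \<Longrightarrow> \<exists>a b. r = {a, b}"
    and card: "card D + card X + 1 = card V" and c: "cb X D = 1" and xy: "x \<in> V" "y \<in> V"
  shows "(\<Sum>e\<in>D. cb (insert {x, y} X) (D - {e}) * dif \<psi> (en e)) =
    \<psi> x + \<psi> y + (\<Sum>r\<in>X. cb (insert {x, y} (X - {r})) D * dif \<psi> r)"
proof -
  have fD: "finite D" using D finE finite_subset by blast
  let ?R = "X \<union> en ` D"
  have pair: "\<exists>a b. r = {a, b}" if "r \<in> ?R" for r using that X en_pair D by blast
  have con: "conn V ?R" using c by (simp add: cb_def split: if_splits)
  have "card V \<le> card ?R + 1" by (rule conn_card_le[OF finV neV _ pair con]) (use X fD in simp)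
  moreover have le: "card ?R \<le> card X + card (en ` D)" "card (en ` D) \<le> card D"
    using card_Un_le[of X "en ` D"] card_image_le[OF fD, of en] by auto
  \<comment> \<open>The count leaves no room for coincidences: edges of \<open>D\<close> are
    parallel neither to each other nor to a pair in \<open>X\<close>, so a sum over
    \<open>?R\<close> splits into one over \<open>X\<close> and one over edges.\<close>
  ultimately have "card ?R = card X + card (en ` D)" "card (en ` D) = card D" using card by auto
  then have disj: "X \<inter> en ` D = {}" and inj: "inj_on en D"
    using X fD card_Un_Int[of X "en ` D"] by (simp_all add: eq_card_imp_inj_on)
  have min: "\<not> conn V (?R - {r})" if "r \<in> ?R" for r
  proof
    assume "conn V (?R - {r})"
    moreover have "finite (?R - {r})" using X fD by simp
    moreover have "\<And>s. s \<in> ?R - {r} \<Longrightarrow> \<exists>a b. s = {a, b}" using pair by blast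
    ultimately have "card V \<le> card (?R - {r}) + 1" using conn_card_le[OF finV neV] by metis
    moreover have "card (?R - {r}) < card ?R" using that X fD by (intro card_Diff1_less) auto
    ultimately show False using card le by linarith
  qed
  have "(\<Sum>r\<in>?R. of_bool (conn V (insert {x, y} (?R - {r}))) * dif \<psi> r) = \<psi> x + \<psi> y"
    by (rule path_sum[OF _ pair con min xy]) (use X fD in auto)
  moreover have "(\<Sum>r\<in>?R. of_bool (conn V (insert {x, y} (?R - {r}))) * dif \<psi> r) =
     (\<Sum>r\<in>X. of_bool (conn V (insert {x, y} (?R - {r}))) * dif \<psi> r) +
     (\<Sum>r\<in>en ` D. of_bool (conn V (insert {x, y} (?R - {r}))) * dif \<psi> r)"
    by (rule sum.union_disjoint) (use X fD disj in auto)
  moreover have "(\<Sum>r\<in>X. of_bool (conn V (insert {x, y} (?R - {r}))) * dif \<psi> r) =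
     (\<Sum>r\<in>X. cb (insert {x, y} (X - {r})) D * dif \<psi> r)"
  proof (rule sum.cong[OF refl])
    fix r assume "r \<in> X"
    then have "?R - {r} = (X - {r}) \<union> en ` D" using disj by blast
    then show "of_bool (conn V (insert {x, y} (?R - {r}))) * dif \<psi> r =
      cb (insert {x, y} (X - {r})) D * dif \<psi> r" by (simp add: cb_def)
  qed
  moreover have "(\<Sum>r\<in>en ` D. of_bool (conn V (insert {x, y} (?R - {r}))) * dif \<psi> r) =
     (\<Sum>e\<in>D. cb (insert {x, y} X) (D - {e}) * dif \<psi> (en e))"
  proof -
    have "?R - {en e} = X \<union> en ` (D - {e})" if "e \<in> D" for e
      using that disj inj by (auto simp: inj_on_def)
    then show ?thesis by (simp add: sum.reindex[OF inj] cb_def)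
  qed
  ultimately show ?thesis
    by (metis (no_types, lifting) add.commute bit_add_self_left)
qed

text \<open>With the variables on \<open>Z\<close> vanishing, this is the potential at
  \<open>z\<close> of a current from \<open>x\<close> to \<open>y\<close>, with denominators
  cleared, in the graph contracted along \<open>X\<close>. It counts the forests in which
  \<open>x\<close> is separated from both \<open>y\<close> and \<open>z\<close>.\<close>

definition pot :: "'e set \<Rightarrow> 'v set set \<Rightarrow> 'v \<Rightarrow> 'v \<Rightarrow> 'v \<Rightarrow> bit" where
  "pot Z X x y z = (\<Sum>D\<in>fam Z (card X + 2). cb (insert {x, y} X) D * cb (insert {x, z} X) D)"

lemma dif_pot:
  assumes X: "finite X" "\<And>r. r \<in> X \<Longrightarrow> \<exists>a b. r = {a, b}" and "x \<in> V" "e \<in> E"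
  shows "dif (pot Z X x y) (en e) =
    (\<Sum>D\<in>fam Z (card X + 2). cb (insert {x, y} X) D * cb (insert (en e) X) D)"
proof -
  have "dif (pot Z X x y) (en e) =
      (\<Sum>D\<in>fam Z (card X + 2). cb (insert {x, y} X) D * dif (\<lambda>z. cb (insert {x, z} X) D) (en e))"
    unfolding pot_def[abs_def] by (rule dif_sum[OF en_pair[OF \<open>e \<in> E\<close>]])
  also have "\<dots> = (\<Sum>D\<in>fam Z (card X + 2). cb (insert {x, y} X) D * cb (insert (en e) X) D)"
  proof (rule sum.cong[OF refl])
    fix D assume "D \<in> fam Z (card X + 2)"
    then have D: "D \<subseteq> E" "card D + card X + 1 < card V" by (auto simp: fam_def)
    show "cb (insert {x, y} X) D * dif (\<lambda>z. cb (insert {x, z} X) D) (en e) =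
      cb (insert {x, y} X) D * cb (insert (en e) X) D"
    proof (cases "cb (insert {x, y} X) D = 1")
      case True
      moreover have "\<exists>a b. {x, y} = {a, b}" by blast
      ultimately show ?thesis using dif_cb[OF D(1) X D(2) \<open>x \<in> V\<close> \<open>e \<in> E\<close> True] by simp
    qed simp
  qed
  finally show ?thesis .
qed

text \<open>An edge of \<open>Z\<close> lies in every \<open>D\<close> of the family, so adding its
  hyperedge joins nothing new; the edge behaves like a contracted one.\<close>

lemma dif_pot_fixed:
  assumes X: "finite X" "\<And>r. r \<in> X \<Longrightarrow> \<exists>a b. r = {a, b}" and "x \<in> V" "Z \<subseteq> E" "e \<in> Z"
  shows "dif (pot Z X x y) (en e) = 0"
proof -
  have "cb (insert (en e) X) D = 0" if "D \<in> fam Z (card X + 2)" for D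
  proof -
    have D: "D \<subseteq> E" "card D + card X + 1 < card V" "e \<in> D" using that \<open>e \<in> Z\<close> by (auto simp: fam_def)
    have "insert e D = D" using D by blast
    then have "cb (insert (en e) X) D = cb X D" using cb_insert_edge[of X e D] by simp
    then show ?thesis using cb_eq_0[OF D(1) X D(2)] by simp
  qed
  then show ?thesis using dif_pot[OF X \<open>x \<in> V\<close>, of e Z y] assms by auto
qed

text \<open>Kirchhoff's theorem modulo 2: the potential that counts spanning forests is harmonic away
  from its source and sink.\<close>

lemma kirchhoff:
  assumes X: "finite X" "\<And>r. r \<in> X \<Longrightarrow> \<exists>a b. r = {a, b}" and xy: "x \<in> V" "y \<in> V" and "Z \<subseteq> E"
    and \<psi>: "\<And>e. e \<in> Z \<Longrightarrow> dif \<psi> (en e) = 0"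
  shows "(\<Sum>e\<in>E. dif (pot Z X x y) (en e) * dif \<psi> (en e)) =
    (\<Sum>D\<in>fam Z (card X + 1). cb X D *
       (\<psi> x + \<psi> y + (\<Sum>r\<in>X. cb (insert {x, y} (X - {r})) D * dif \<psi> r)))"
proof -
  let ?A = "fam Z (card X + 2)" and ?B = "fam Z (card X + 1)"
  let ?g = "\<lambda>(D, e). cb (insert {x, y} X) D * cb (insert (en e) X) D * dif \<psi> (en e)"
  let ?h = "\<lambda>(D, e). cb X D * cb (insert {x, y} X) (D - {e}) * dif \<psi> (en e)"
  have fB: "finite D" if "D \<in> ?B" for D using that finE finite_subset unfolding fam_def by blast
  have "(\<Sum>e\<in>E. dif (pot Z X x y) (en e) * dif \<psi> (en e)) =
    (\<Sum>e\<in>E. \<Sum>D\<in>?A. cb (insert {x, y} X) D * cb (insert (en e) X) D * dif \<psi> (en e))"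
    by (rule sum.cong) (simp_all add: dif_pot[OF X \<open>x \<in> V\<close>] sum_distrib_right)
  also have "\<dots> = (\<Sum>D\<in>?A. \<Sum>e\<in>E. cb (insert {x, y} X) D * cb (insert (en e) X) D * dif \<psi> (en e))"
    by (rule sum.swap)
  also have "\<dots> = sum ?g (?A \<times> E)"
    by (simp add: sum.cartesian_product)
  \<comment> \<open>Adding an edge \<open>e\<close> to a forest that it completes gives a tree with
    a marked edge. Pairs with \<open>e\<close> already in \<open>D\<close> vanish because
    \<open>D\<close> and \<open>X\<close> are too small to connect \<open>V\<close>; marked edges in
    \<open>Z\<close> vanish because \<open>\<psi>\<close> has no difference there.\<close>
  also have "\<dots> = sum ?h (SIGMA D:?B. D)"
  proof (rule sum.reindex_bij_witness_not_neutral[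
      where S' = "{(D, e). D \<in> ?A \<and> e \<in> D}" and T' = "{(D, e). D \<in> ?B \<and> e \<in> D \<and> e \<in> Z}"
        and i = "\<lambda>(D, e). (D - {e}, e)" and j = "\<lambda>(D, e). (insert e D, e)"])
    show "finite {(D, e). D \<in> ?A \<and> e \<in> D}"
      by (rule finite_subset[of _ "?A \<times> E"]) (auto simp: fin_fam finE fam_def)
    show "finite {(D, e). D \<in> ?B \<and> e \<in> D \<and> e \<in> Z}"
      by (rule finite_subset[of _ "?B \<times> E"]) (auto simp: fin_fam finE fam_def)
    fix p assume p: "p \<in> ?A \<times> E - {(D, e). D \<in> ?A \<and> e \<in> D}"
    obtain D e where pe: "p = (D, e)" by (cases p)
    have e: "e \<notin> D" "e \<in> E" "e \<notin> Z" and D: "D \<in> ?A" using p pe by (auto simp: fam_def)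
    have fD: "finite D" using D finE finite_subset unfolding fam_def by blast
    show "(\<lambda>(D, e). (D - {e}, e)) ((\<lambda>(D, e). (insert e D, e)) p) = p" using e by (simp add: pe)
    show "(\<lambda>(D, e). (insert e D, e)) p \<in> (SIGMA D:?B. D) - {(D, e). D \<in> ?B \<and> e \<in> D \<and> e \<in> Z}"
      using e D fD by (auto simp: pe fam_def)
  next
    fix p assume "p \<in> ?A \<times> E"
    then obtain D e where pe: "p = (D, e)" and D: "D \<in> ?A" by blast
    show "?h ((\<lambda>(D, e). (insert e D, e)) p) = ?g p"
    proof (cases "e \<in> D")
      case False
      then show ?thesis by (simp add: pe cb_insert_edge ac_simps)
    next
      case True
      have D': "D \<subseteq> E" "card D + card X + 1 < card V" using D by (auto simp: fam_def)
      have "insert e D = D" using True by blast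
      moreover have "cb X D = 0" using cb_eq_0[OF D'(1) X D'(2)] .
      ultimately show ?thesis using cb_insert_edge[of X e D] by (simp add: pe)
    qed
  next
    fix q assume q: "q \<in> (SIGMA D:?B. D) - {(D, e). D \<in> ?B \<and> e \<in> D \<and> e \<in> Z}"
    obtain D e where pe: "q = (D, e)" by (cases q)
    have e: "e \<in> D" "e \<notin> Z" and D: "D \<in> ?B" using q pe by auto
    have "card D = Suc (card (D - {e}))" using card.remove[OF fB[OF D] e(1)] .
    then show "(\<lambda>(D, e). (D - {e}, e)) q \<in> ?A \<times> E - {(D, e). D \<in> ?A \<and> e \<in> D}"
      using e D by (auto simp: pe fam_def)
    show "(\<lambda>(D, e). (insert e D, e)) ((\<lambda>(D, e). (D - {e}, e)) q) = q" using e by (auto simp: pe)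
  next
    fix p assume "p \<in> {(D, e). D \<in> ?A \<and> e \<in> D}"
    then obtain D e where pe: "p = (D, e)" and D: "D \<in> ?A" "e \<in> D" by blast
    then have D': "D \<subseteq> E" "card D + card X + 1 < card V" by (auto simp: fam_def)
    have "insert e D = D" using D by blast
    then have "cb (insert (en e) X) D = cb X D" using cb_insert_edge[of X e D] by simp
    then show "?g p = 0" using cb_eq_0[OF D'(1) X D'(2)] by (simp add: pe)
  next
    fix q assume "q \<in> {(D, e). D \<in> ?B \<and> e \<in> D \<and> e \<in> Z}"
    then show "?h q = 0" using \<psi> by auto
  qed
  also have "\<dots> = (\<Sum>D\<in>?B. \<Sum>e\<in>D. cb X D * cb (insert {x, y} X) (D - {e}) * dif \<psi> (en e))"
    by (rule sum.Sigma[symmetric]) (auto simp: fin_fam fB)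
  also have "\<dots> = (\<Sum>D\<in>?B. cb X D *
       (\<psi> x + \<psi> y + (\<Sum>r\<in>X. cb (insert {x, y} (X - {r})) D * dif \<psi> r)))"
  proof (rule sum.cong[OF refl])
    fix D assume "D \<in> ?B"
    then have D: "D \<subseteq> E" "card D + card X + 1 = card V" by (auto simp: fam_def)
    have "(\<Sum>e\<in>D. cb X D * cb (insert {x, y} X) (D - {e}) * dif \<psi> (en e)) =
       cb X D * (\<Sum>e\<in>D. cb (insert {x, y} X) (D - {e}) * dif \<psi> (en e))"
      by (simp add: sum_distrib_left mult.assoc)
    also have "\<dots> = cb X D * (\<psi> x + \<psi> y + (\<Sum>r\<in>X. cb (insert {x, y} (X - {r})) D * dif \<psi> r))"
      using edge_path_sum[OF D(1) X D(2) _ xy] by (cases "cb X D") simp_all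
    finally show "(\<Sum>e\<in>D. cb X D * cb (insert {x, y} X) (D - {e}) * dif \<psi> (en e)) =
       cb X D * (\<psi> x + \<psi> y + (\<Sum>r\<in>X. cb (insert {x, y} (X - {r})) D * dif \<psi> r))" .
  qed
  finally show ?thesis .
qed

text \<open>This and the next three are spanning forest polynomials at the point with zero set
  \<open>Z\<close>, modulo 2: a monomial survives exactly if its forest contains \<open>Z\<close>.
  In \<open>npair\<close> and \<open>ntriple\<close> the marked vertices lie in distinct components;
  in \<open>nsep\<close> only \<open>x\<close> is separated from the other two.\<close>

definition ntree :: "'e set \<Rightarrow> bit" where
  "ntree Z = (\<Sum>D\<in>fam Z 1. cb {} D)"

definition npair :: "'v \<Rightarrow> 'v \<Rightarrow> 'e set \<Rightarrow> bit" where
  "npair x y Z = (\<Sum>D\<in>fam Z 2. cb {{x, y}} D)"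

definition nsep :: "'v \<Rightarrow> 'v \<Rightarrow> 'v \<Rightarrow> 'e set \<Rightarrow> bit" where
  "nsep x y z Z = (\<Sum>D\<in>fam Z 2. cb {{x, y}} D * cb {{x, z}} D)"

definition ntriple :: "'v \<Rightarrow> 'v \<Rightarrow> 'v \<Rightarrow> 'e set \<Rightarrow> bit" where
  "ntriple x y z Z = (\<Sum>D\<in>fam Z 3. cb {{x, y, z}} D)"

lemma cb_triple: "cb (insert {x, y, z} X) D = cb (insert {x, y} (insert {x, z} X)) D"
  by (simp add: cb_def conn_insert_triple)

lemma nsep_commute: "nsep x y z Z = nsep x z y Z"
  by (simp add: nsep_def mult.commute)

text \<open>Two components separate none or two of the three pairs. With more components no single
  pair reconnects \<open>D\<close>, and all terms vanish.\<close>

lemma cb_split: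
  assumes "D \<in> fam Z 2" "x \<in> V" "y \<in> V" "z \<in> V"
  shows "cb {{x, y}} D + cb {{x, z}} D + cb {{y, z}} D = 0"
proof (cases "cb {{x, y}} D = 1 \<or> cb {{x, z}} D = 1 \<or> cb {{y, z}} D = 1")
  case True
  then obtain r where "cb (insert r {}) D = 1" "\<exists>a b. r = {a, b}" by blast
  from cb_add_path[OF _ _ _ _ assms(2-4) this] show ?thesis using assms by (simp add: fam_def)
next
  case False
  then show ?thesis by simp
qed

text \<open>When \<open>x\<close> and \<open>y\<close> are separated, the third vertex lies either
  with \<open>y\<close> or with \<open>x\<close>.\<close>

lemma npair_eq_nsep:
  assumes "x \<in> V" "y \<in> V" "z \<in> V"
  shows "npair x y Z = nsep x y z Z + nsep y x z Z"
  unfolding npair_def nsep_def sum.distrib[symmetric]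
proof (rule sum.cong[OF refl])
  fix D assume "D \<in> fam Z 2"
  from cb_split[OF this assms]
  show "cb {{x, y}} D = cb {{x, y}} D * cb {{x, z}} D + cb {{y, x}} D * cb {{y, z}} D"
    unfolding insert_commute[of y x "{}"]
    by (cases "cb {{x, y}} D"; cases "cb {{x, z}} D"; cases "cb {{y, z}} D") simp_all
qed

text \<open>The form that multiplies differences along edges and sums them is symmetric. For the
  potential of the graph and that of the graph with \<open>x\<close> and \<open>y\<close>
  identified, \<open>kirchhoff\<close> evaluates it in two ways, one for each side of the identity.
  The term \<open>nsep x y z Z\<close> arises as a square.\<close>

lemma dodgson:
  assumes "x \<in> V" "y \<in> V" "z \<in> V" and Z: "Z \<subseteq> E"
  shows "ntree Z * ntriple x y z Z = npair x y Z * npair x z Z + nsep x y z Z"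
proof -
  let ?X = "{{x, y}}"
  have X: "finite ?X" "\<And>r. r \<in> ?X \<Longrightarrow> \<exists>a b. r = {a, b}" by auto
  have X0: "finite {}" "\<And>r. r \<in> {} \<Longrightarrow> \<exists>a b. r = {a, b}" by auto
  let ?p1 = "pot Z {} x z" and ?p2 = "pot Z ?X x z"
  \<comment> \<open>At the source the second factor adds \<open>{x, x}\<close>, which joins nothing,
    so both potentials vanish there.\<close>
  have 1: "?p1 x = 0" unfolding pot_def
    by (rule sum.neutral) (auto simp: fam_def intro!: cb_eq_0)
  have 2: "?p2 x = 0" unfolding pot_def
    by (rule sum.neutral) (auto simp: fam_def intro!: cb_eq_0)
  have sq: "b * b = b" for b :: bit by (cases b) auto
  have 3: "?p1 z = npair x z Z" "?p1 y = nsep x y z Z"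
    by (simp_all add: pot_def npair_def nsep_def mult.commute sq del: add_2_eq_Suc add_2_eq_Suc')
  have 4: "?p2 z = ntriple x y z Z"
    by (simp add: pot_def ntriple_def cb_triple insert_commute sq numeral_3_eq_3)
  have "(\<Sum>e\<in>E. dif ?p1 (en e) * dif ?p2 (en e)) =
     (\<Sum>D\<in>fam Z 1. cb {} D * (?p2 x + ?p2 z))"
    using kirchhoff[OF X0 \<open>x \<in> V\<close> \<open>z \<in> V\<close> Z dif_pot_fixed[OF X \<open>x \<in> V\<close> Z]] by simp
  also have "\<dots> = ntree Z * ntriple x y z Z"
    by (simp add: 2 4 ntree_def sum_distrib_right)
  finally have a: "(\<Sum>e\<in>E. dif ?p1 (en e) * dif ?p2 (en e)) = ntree Z * ntriple x y z Z" .
  \<comment> \<open>With the roles exchanged, the pair \<open>{x, y}\<close> in \<open>?X\<close>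
    contributes an extra path term, which yields the square of \<open>nsep\<close>.\<close>
  have "(\<Sum>e\<in>E. dif ?p2 (en e) * dif ?p1 (en e)) =
     (\<Sum>D\<in>fam Z 2. cb ?X D * (?p1 x + ?p1 z + cb {{x, z}} D * (?p1 x + ?p1 y)))"
    using kirchhoff[OF X \<open>x \<in> V\<close> \<open>z \<in> V\<close> Z dif_pot_fixed[OF X0 \<open>x \<in> V\<close> Z]]
    by (simp add: numeral_2_eq_2)
  also have "\<dots> = npair x y Z * npair x z Z + nsep x y z Z * nsep x y z Z"
    by (simp add: 1 3 distrib_left sum.distrib npair_def nsep_def sum_distrib_right mult.assoc)
  finally have "(\<Sum>e\<in>E. dif ?p2 (en e) * dif ?p1 (en e)) = npair x y Z * npair x z Z + nsep x y z Z"
    by (simp only: sq)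
  then show ?thesis using a by (simp add: mult.commute)
qed

end

section \<open>Three-valent vertices\<close>

text \<open>Potentials on \<open>V\<close> constant on \<open>X\<close> correspond to potentials on
  \<open>insert u V\<close> constant along the star: the value at \<open>u\<close> is the common
  value on \<open>X\<close>.\<close>

lemma conn_star:
  assumes "u \<notin> V" "X \<noteq> {}" "X \<subseteq> V" and R: "\<And>r. r \<in> R \<Longrightarrow> r \<subseteq> V"
  shows "conn (insert u V) (R \<union> (\<lambda>x. {u, x}) ` X) = conn V (insert X R)"
proof
  assume c: "conn (insert u V) (R \<union> (\<lambda>x. {u, x}) ` X)"
  obtain x where x: "x \<in> X" using assms by blast
  show "conn V (insert X R)"
    unfolding conn_def
  proof (intro allI impI ballI)
    fix \<psi> :: "'a \<Rightarrow> bit" and a b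
    assume \<psi>: "\<forall>r\<in>insert X R. dif \<psi> r = 0" and ab: "a \<in> V" "b \<in> V"
    let ?\<phi> = "\<psi>(u := \<psi> x)"
    have "dif ?\<phi> r = 0" if rin: "r \<in> R \<union> (\<lambda>x. {u, x}) ` X" for r
    proof (cases "r \<in> R")
      case True
      then have "dif ?\<phi> r = dif \<psi> r" using R[OF True] \<open>u \<notin> V\<close> by (intro dif_cong) auto
      then show ?thesis using \<psi> True by simp
    next
      case False
      then obtain y where y: "y \<in> X" "r = {u, y}" using rin by blast
      moreover have "dif \<psi> X = 0" using \<psi> by simp
      ultimately have "\<psi> y = \<psi> x" using x unfolding dif_eq_0_iff by blast
      moreover have "y \<noteq> u" using y assms by auto
      ultimately show ?thesis using y by simp
    qed
    then have "?\<phi> a = ?\<phi> b" using connD[OF c, of ?\<phi> a b] ab by blast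
    then show "\<psi> a = \<psi> b" using ab \<open>u \<notin> V\<close> by (auto split: if_splits)
  qed
next
  assume c: "conn V (insert X R)"
  obtain x where x: "x \<in> X" using assms by blast
  show "conn (insert u V) (R \<union> (\<lambda>x. {u, x}) ` X)"
    unfolding conn_def
  proof (intro allI impI)
    fix \<psi> :: "'a \<Rightarrow> bit"
    assume \<psi>: "\<forall>r\<in>R \<union> (\<lambda>x. {u, x}) ` X. dif \<psi> r = 0"
    have X: "\<psi> y = \<psi> u" if "y \<in> X" for y
    proof -
      have "dif \<psi> {u, y} = 0" using \<psi> that by blast
      then show ?thesis by (simp add: bit_add_eq_0_iff)
    qed
    have "dif \<psi> r = 0" if "r \<in> insert X R" for r
    proof (cases "r = X")
      case True
      have "\<psi> a = \<psi> b" if "a \<in> X" "b \<in> X" for a b using X[OF that(1)] X[OF that(2)] by simp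
      then show ?thesis unfolding True dif_eq_0_iff by blast
    next
      case False
      then show ?thesis using that \<psi> by simp
    qed
    then have "\<psi> a = \<psi> x" if "a \<in> V" for a using connD[OF c, of \<psi> a x] that x assms by blast
    then have "\<psi> a = \<psi> u" if "a \<in> insert u V" for a using X[OF x] that by auto
    then show "\<forall>a\<in>insert u V. \<forall>b\<in>insert u V. \<psi> a = \<psi> b" by metis
  qed
qed

lemma not_conn_isolated:
  assumes "u \<in> V" "y \<in> V" "y \<noteq> u" and R: "\<And>r. r \<in> R \<Longrightarrow> u \<notin> r"
  shows "\<not> conn V R"
proof
  assume c: "conn V R"
  have "dif (\<lambda>z. of_bool (z = u)) r = 0" if "r \<in> R" for r
    using R[OF that] by (auto simp: dif_eq_0_iff)
  then have "(of_bool (u = u) :: bit) = of_bool (y = u)" using connD[OF c _ assms(1,2)] by blast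
  then show False using assms by simp
qed

section \<open>Sums over sets of edges\<close>

lemma sum_Pow_Un:
  fixes f :: "'a set \<Rightarrow> 'b::comm_monoid_add"
  assumes "A \<inter> B = {}"
  shows "sum f (Pow (A \<union> B)) = (\<Sum>S\<in>Pow B. \<Sum>D\<in>Pow A. f (D \<union> S))"
proof -
  have "sum f (Pow (A \<union> B)) = (\<Sum>(S, D)\<in>Pow B \<times> Pow A. f (D \<union> S))"
    by (rule sum.reindex_bij_witness[of _ "\<lambda>(S, D). D \<union> S" "\<lambda>D. (D \<inter> B, D \<inter> A)"])
       (use assms in \<open>auto simp: Int_Un_distrib2 intro!: arg_cong[where f = f]\<close>)
  then show ?thesis by (simp add: sum.cartesian_product)
qed

text \<open>The number \<open>2 ^ card D\<close> of subsets is odd only for the empty set. Summing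
  over all zero sets therefore selects pairs of a tree and a forest that are disjoint.\<close>

lemma sum_subset_indicator:
  assumes "finite E" "D \<subseteq> E"
  shows "(\<Sum>Z\<in>Pow E. of_bool (Z \<subseteq> D)) = (of_bool (D = {}) :: bit)"
proof -
  have "(\<Sum>Z\<in>Pow E. of_bool (Z \<subseteq> D)) = (\<Sum>Z\<in>Pow D. 1 :: bit)"
    by (rule sum.mono_neutral_cong_right) (use assms in auto)
  also have "\<dots> = of_nat (2 ^ card D)"
    using assms by (simp add: card_Pow finite_subset)
  also have "\<dots> = of_bool (D = {})"
    using assms by (cases "D = {}") (auto simp: card_gt_0_iff finite_subset)
  finally show ?thesis .
qed

lemma sum_Pow_triple:
  fixes f :: "'e set \<Rightarrow> 'c::comm_monoid_add"
  assumes "e1 \<noteq> e2" "e1 \<noteq> e3" "e2 \<noteq> e3"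
  shows "sum f (Pow {e1, e2, e3}) =
    f {} + f {e1} + f {e2} + f {e3} + f {e1, e2} + f {e1, e3} + f {e2, e3} + f {e1, e2, e3}"
proof -
  have PA: "Pow {e1, e2, e3} = {{}, {e1}, {e2}, {e3}, {e1, e2}, {e1, e3}, {e2, e3}, {e1, e2, e3}}" by (auto simp: Pow_insert)
  have ne: "{e1} \<noteq> {e2}" "{e1} \<noteq> {e3}" "{e2} \<noteq> {e3}" "{e1, e2} \<noteq> {e1, e3}" "{e1, e2} \<noteq> {e2, e3}" "{e1, e3} \<noteq> {e2, e3}"
    "\<And>a b c. {a, b} = {c} \<Longrightarrow> a = b" "{e1, e2, e3} \<noteq> {e1, e2}" "{e1, e2, e3} \<noteq> {e1, e3}" "{e1, e2, e3} \<noteq> {e2, e3}"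
    "\<And>a b c d. {a, b, c} = {d} \<Longrightarrow> a = b"
    using assms by auto
  show ?thesis unfolding PA using ne assms by (simp add: add.assoc)
qed

text \<open>The value of \<open>\<Psi>\<close> at the point with zero set \<open>Z\<close>, as a
  parity, with a spanning tree encoded as a connecting set of \<open>card V - 1\<close> edges. It
  stands outside \<open>incidence\<close> so that inside that locale new vertices and edges can be
  adjoined.\<close>

definition trees :: "'v set \<Rightarrow> 'e set \<Rightarrow> ('e \<Rightarrow> 'v set) \<Rightarrow> 'e set \<Rightarrow> bit" where
  "trees V E en Z = (\<Sum>D\<in>Pow E. of_bool (Z \<subseteq> D \<and> card D + 1 = card V \<and> conn V (en ` D)))"

definition zeros :: "'v set \<Rightarrow> 'e set \<Rightarrow> ('e \<Rightarrow> 'v set) \<Rightarrow> nat" where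
  "zeros V E en = (\<Sum>Z\<in>Pow E. of_bool (trees V E en Z = 0))"

text \<open>Here \<open>f0\<close>, \<open>f4\<close> and \<open>f1\<close>, \<open>f2\<close>,
  \<open>f3\<close> stand for \<open>ntree\<close>, \<open>ntriple\<close> and the three values of
  \<open>nsep\<close>. The eight terms are the points over one zero set of the smaller graph,
  according to which star variables vanish. The Dodgson identity makes their number of zeros
  divisible by 4 and determines the parity of the quotient.\<close>

lemma star_fibre:
  fixes f0 f1 f2 f3 f4 :: bit
  assumes "f0 * f4 = (f1 + f2) * (f1 + f3) + f1"
  shows "\<exists>m. of_bool (f0 + f4 = 0) + of_bool (f0 + (f2 + f3) + f4 = 0) + of_bool (f0 + (f1 + f3) + f4 = 0) +
     of_bool (f0 + (f1 + f2) + f4 = 0) + of_bool ((f1 + f2) + f4 = 0) + of_bool ((f1 + f3) + f4 = 0) +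
     of_bool ((f2 + f3) + f4 = 0) + of_bool (f4 = 0) = 4 * m \<and>
     of_nat m = f0 + (1 + f0) * (f1 + f2 + f3)"
proof -
  define n :: nat where "n = of_bool (f0 + f4 = 0) + of_bool (f0 + (f2 + f3) + f4 = 0) + of_bool (f0 + (f1 + f3) + f4 = 0) +
     of_bool (f0 + (f1 + f2) + f4 = 0) + of_bool ((f1 + f2) + f4 = 0) + of_bool ((f1 + f3) + f4 = 0) +
     of_bool ((f2 + f3) + f4 = 0) + of_bool (f4 = 0)"
  have "n = 4 * (n div 4) \<and> of_nat (n div 4) = f0 + (1 + f0) * (f1 + f2 + f3)"
    using assms unfolding n_def
    by (cases f0; cases f1; cases f2; cases f3; cases f4) simp_all
  then show ?thesis unfolding n_def by blast
qed

context incidence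
begin

lemma sum_fam: "sum f (fam Z k) = (\<Sum>D\<in>Pow E. of_bool (Z \<subseteq> D \<and> card D + k = card V) * f D)"
  for f :: "'e set \<Rightarrow> bit"
  by (rule sum.mono_neutral_cong_left) (auto simp: fam_def finE)

text \<open>A forest with two components separates none or two of the three pairs, so this
  elementary symmetric function is the indicator that \<open>x\<close>, \<open>y\<close>,
  \<open>z\<close> do not all lie in one component.\<close>

definition sep :: "'v \<Rightarrow> 'v \<Rightarrow> 'v \<Rightarrow> 'e set \<Rightarrow> bit" where
  "sep x y z F = cb {{x, y}} F * cb {{x, z}} F + cb {{x, y}} F * cb {{y, z}} F + cb {{x, z}} F * cb {{y, z}} F"

text \<open>The parity of the number of partitions into a tree and a forest. No sizes are
  prescribed: when \<open>card E + 3 = 2 * card V\<close>, the connectivity factors force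
  them.\<close>

definition nconf :: "'v \<Rightarrow> 'v \<Rightarrow> 'v \<Rightarrow> bit" where
  "nconf x y z = (\<Sum>T\<in>Pow E. cb {} T * sep x y z (E - T))"

lemma nsep_total:
  "nsep x y z Z + nsep y x z Z + nsep z x y Z = (\<Sum>D\<in>fam Z 2. sep x y z D)"
  by (simp add: nsep_def sep_def sum.distrib insert_commute)

text \<open>Expanding the product gives pairs of a tree \<open>T\<close> and a forest
  \<open>F\<close>, each counted once per \<open>Z\<close> inside \<open>T \<inter> F\<close>, hence
  an odd number of times only if they are disjoint. The number of edges then makes \<open>F\<close>
  the complement of \<open>T\<close>.\<close>

lemma sum_ntree_nsep:
  assumes E: "card E + 3 = 2 * card V"
  shows "(\<Sum>Z\<in>Pow E. ntree Z * (nsep x y z Z + nsep y x z Z + nsep z x y Z)) = nconf x y z"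
proof -
  let ?t = "\<lambda>T. of_bool (card T + 1 = card V) * cb {} T"
  let ?s = "\<lambda>F. of_bool (card F + 2 = card V) * sep x y z F"
  have "ntree Z * (nsep x y z Z + nsep y x z Z + nsep z x y Z) =
      (\<Sum>T\<in>Pow E. \<Sum>F\<in>Pow E. of_bool (Z \<subseteq> T \<inter> F) * (?t T * ?s F))" for Z
    unfolding nsep_total ntree_def sum_fam sum_product
    by (intro sum.cong refl) (auto simp: of_bool_def)
  then have "(\<Sum>Z\<in>Pow E. ntree Z * (nsep x y z Z + nsep y x z Z + nsep z x y Z)) =
      (\<Sum>Z\<in>Pow E. \<Sum>T\<in>Pow E. \<Sum>F\<in>Pow E. of_bool (Z \<subseteq> T \<inter> F) * (?t T * ?s F))"
    by (simp only:)
  also have "\<dots> = (\<Sum>T\<in>Pow E. \<Sum>Z\<in>Pow E. \<Sum>F\<in>Pow E. of_bool (Z \<subseteq> T \<inter> F) * (?t T * ?s F))"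
    by (rule sum.swap)
  also have "\<dots> = (\<Sum>T\<in>Pow E. \<Sum>F\<in>Pow E. \<Sum>Z\<in>Pow E. of_bool (Z \<subseteq> T \<inter> F) * (?t T * ?s F))"
    by (intro sum.cong refl sum.swap)
  also have "\<dots> = (\<Sum>T\<in>Pow E. \<Sum>F\<in>Pow E. of_bool (T \<inter> F = {}) * (?t T * ?s F))"
  proof (intro sum.cong refl)
    fix T F assume "T \<in> Pow E" "F \<in> Pow E"
    then have "(\<Sum>Z\<in>Pow E. of_bool (Z \<subseteq> T \<inter> F)) = (of_bool (T \<inter> F = {}) :: bit)"
      by (intro sum_subset_indicator finE) auto
    then show "(\<Sum>Z\<in>Pow E. of_bool (Z \<subseteq> T \<inter> F) * (?t T * ?s F)) = of_bool (T \<inter> F = {}) * (?t T * ?s F)"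
      by (simp only: sum_distrib_right[symmetric])
  qed
  also have "\<dots> = (\<Sum>T\<in>Pow E. cb {} T * sep x y z (E - T))"
  proof (intro sum.cong refl)
    fix T assume T: "T \<in> Pow E"
    then have fT: "finite T" using finE finite_subset by blast
    have cET: "card T + card (E - T) = card E"
      using T finE fT by (simp add: card_Diff_subset card_mono)
    have "(\<Sum>F\<in>Pow E. of_bool (T \<inter> F = {}) * (?t T * ?s F)) =
      (\<Sum>F\<in>Pow E. if F = E - T then ?t T * ?s F else 0)"
    proof (intro sum.cong refl)
      fix F assume F: "F \<in> Pow E"
      have "F = E - T" if "T \<inter> F = {}" "card T + 1 = card V" "card F + 2 = card V"
      proof (rule card_subset_eq)
        show "F \<subseteq> E - T" using that F by auto
        show "card F = card (E - T)" using that E cET by linarith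
      qed (use finE in simp)
      then show "of_bool (T \<inter> F = {}) * (?t T * ?s F) = (if F = E - T then ?t T * ?s F else 0)"
        by (cases "F = E - T") (auto simp: of_bool_def)
    qed
    also have "\<dots> = ?t T * ?s (E - T)" using finE by (simp add: sum.delta)
    \<comment> \<open>Connectivity bounds both sizes from below, and the bounds add up to
      \<open>card E\<close>, so the sizes are exact.\<close>
    also have "\<dots> = cb {} T * sep x y z (E - T)"
    proof (cases "cb {} T = 1 \<and> sep x y z (E - T) = 1")
      case True
      then have "\<exists>r a b. cb {r} (E - T) = 1 \<and> r = {a, b}"
        by (cases "cb {{x, y}} (E - T)"; cases "cb {{x, z}} (E - T)"; cases "cb {{y, z}} (E - T)") (auto simp: sep_def)
      then obtain r a b where r: "cb {r} (E - T) = 1" "r = {a, b}" by blast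
      have "\<not> card (E - T) + card {r} + 1 < card V"
        using cb_eq_0[of "E - T" "{r}"] r by auto
      moreover have "\<not> card T + card ({}::'v set set) + 1 < card V"
        using cb_eq_0[of T "{}"] T True by auto
      ultimately have "card T + 1 = card V \<and> card (E - T) + 2 = card V"
        using cET E by simp
      then show ?thesis by simp
    next
      case False
      then show ?thesis by auto
    qed
    finally show "(\<Sum>F\<in>Pow E. of_bool (T \<inter> F = {}) * (?t T * ?s F)) = cb {} T * sep x y z (E - T)" .
  qed
  finally show ?thesis by (simp add: nconf_def)
qed

text \<open>Each \<open>D\<close> is counted once per subset, an even number of times unless
  \<open>D\<close> is empty; \<open>k < card V\<close> keeps the empty set out of the
  families.\<close>

lemma sum_sum_fam:
  assumes "k < card V"
  shows "(\<Sum>Z\<in>Pow E. sum f (fam Z k)) = (0 :: bit)"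
proof -
  have "(\<Sum>Z\<in>Pow E. sum f (fam Z k)) =
    (\<Sum>Z\<in>Pow E. \<Sum>D\<in>Pow E. of_bool (Z \<subseteq> D) * (of_bool (card D + k = card V) * f D))"
    unfolding sum_fam by (intro sum.cong refl) (auto simp: of_bool_def)
  also have "\<dots> = (\<Sum>D\<in>Pow E. \<Sum>Z\<in>Pow E. of_bool (Z \<subseteq> D) * (of_bool (card D + k = card V) * f D))"
    by (rule sum.swap)
  also have "\<dots> = 0"
  proof (rule sum.neutral, rule ballI)
    fix D assume "D \<in> Pow E"
    then have "(\<Sum>Z\<in>Pow E. of_bool (Z \<subseteq> D)) = (of_bool (D = {}) :: bit)"
      by (intro sum_subset_indicator finE) auto
    then have "(\<Sum>Z\<in>Pow E. of_bool (Z \<subseteq> D) * (of_bool (card D + k = card V) * f D)) =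
        of_bool (D = {}) * (of_bool (card D + k = card V) * f D)"
      by (simp only: sum_distrib_right[symmetric])
    also have "\<dots> = 0" using assms by (cases "D = {}") auto
    finally show "(\<Sum>Z\<in>Pow E. of_bool (Z \<subseteq> D) * (of_bool (card D + k = card V) * f D)) = 0" .
  qed
  finally show ?thesis .
qed

text \<open>A tree of the larger graph splits into its star edges \<open>S\<close> and the rest
  \<open>D\<close>; the star becomes one hyperedge, and without star edges \<open>u\<close> would be
  isolated. Since \<open>u\<close> adds one vertex, \<open>D\<close> has
  \<open>card V - card S\<close> elements, whence the index of \<open>fam\<close>.\<close>

lemma trees_star:
  assumes u: "u \<notin> V" and A: "finite A" "A \<inter> E = {}" and en: "\<And>e. e \<in> A \<Longrightarrow> en e = {u, x e}"
    and x: "\<And>e. e \<in> A \<Longrightarrow> x e \<in> V" and S0: "S0 \<subseteq> A" and Z: "Z \<subseteq> E"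
  shows "trees (insert u V) (E \<union> A) en (Z \<union> S0) =
    (\<Sum>S\<in>Pow A. of_bool (S0 \<subseteq> S \<and> S \<noteq> {}) * (\<Sum>D\<in>fam Z (card S). cb {x ` S} D))"
proof -
  have "trees (insert u V) (E \<union> A) en (Z \<union> S0) = (\<Sum>S\<in>Pow A. \<Sum>D\<in>Pow E.
     of_bool (Z \<union> S0 \<subseteq> D \<union> S \<and> card (D \<union> S) + 1 = card (insert u V) \<and> conn (insert u V) (en ` (D \<union> S))))"
    unfolding trees_def by (rule sum_Pow_Un) (use A in blast)
  also have "\<dots> = (\<Sum>S\<in>Pow A. \<Sum>D\<in>Pow E. of_bool (S0 \<subseteq> S \<and> S \<noteq> {}) *
      (of_bool (Z \<subseteq> D \<and> card D + card S = card V) * cb {x ` S} D))"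
  proof (intro sum.cong refl)
    fix S D assume S: "S \<in> Pow A" and D: "D \<in> Pow E"
    then have fin: "finite S" "finite D" using A finE finite_subset by blast+
    have disj: "D \<inter> S = {}" using S D A by blast
    have 1: "Z \<union> S0 \<subseteq> D \<union> S \<longleftrightarrow> Z \<subseteq> D \<and> S0 \<subseteq> S" using S D A S0 Z by blast
    have 2: "card (D \<union> S) + 1 = card (insert u V) \<longleftrightarrow> card D + card S = card V"
      using fin disj u finV by (simp add: card_Un_disjoint)
    have DV: "\<And>r. r \<in> en ` D \<Longrightarrow> r \<subseteq> V" using D enV by blast
    have 3: "of_bool (conn (insert u V) (en ` (D \<union> S))) = of_bool (S \<noteq> {}) * cb {x ` S} D"
    proof (cases "S = {}")
      case True
      obtain y where "y \<in> V" using neV by blast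
      then have "\<not> conn (insert u V) (en ` D)"
        using u DV by (intro not_conn_isolated[of u _ y]) blast+
      then show ?thesis using True by simp
    next
      case False
      have "en ` S = (\<lambda>y. {u, y}) ` x ` S"
        unfolding image_image by (rule image_cong) (use S en in auto)
      moreover have "x ` S \<subseteq> V" "x ` S \<noteq> {}" using S x False by auto
      ultimately have "conn (insert u V) (en ` (D \<union> S)) = conn V (insert (x ` S) (en ` D))"
        unfolding image_Un using conn_star[of u V "x ` S" "en ` D"] u DV by simp
      then show ?thesis using False by (simp add: cb_def)
    qed
    show "of_bool (Z \<union> S0 \<subseteq> D \<union> S \<and> card (D \<union> S) + 1 = card (insert u V) \<and> conn (insert u V) (en ` (D \<union> S))) =
      of_bool (S0 \<subseteq> S \<and> S \<noteq> {}) * (of_bool (Z \<subseteq> D \<and> card D + card S = card V) * cb {x ` S} D)"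
      unfolding 1 2 of_bool_conj 3 by (simp only: ac_simps)
  qed
  also have "\<dots> = (\<Sum>S\<in>Pow A. of_bool (S0 \<subseteq> S \<and> S \<noteq> {}) * (\<Sum>D\<in>fam Z (card S). cb {x ` S} D))"
    unfolding sum_fam sum_distrib_left ..
  finally show ?thesis .
qed

text \<open>Over each zero set \<open>Z\<close> of the smaller graph, \<open>star_fibre\<close>
  gives \<open>4 * m Z\<close> zeros. In the parity of the sum of the \<open>m Z\<close>, the terms
  linear in forest counts cancel by \<open>sum_sum_fam\<close>, and the product term is evaluated by
  \<open>sum_ntree_nsep\<close>.\<close>

lemma zeros_star:
  assumes u: "u \<notin> V" and dist: "e1 \<noteq> e2" "e1 \<noteq> e3" "e2 \<noteq> e3" and E: "e1 \<notin> E" "e2 \<notin> E" "e3 \<notin> E"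
    and en: "en e1 = {u, x1}" "en e2 = {u, x2}" "en e3 = {u, x3}" and x: "x1 \<in> V" "x2 \<in> V" "x3 \<in> V"
    and card: "card E + 3 = 2 * card V" "3 \<le> card V"
  shows "of_nat (zeros (insert u V) (E \<union> {e1, e2, e3}) en div 4) = nconf x1 x2 x3"
proof -
  let ?A = "{e1, e2, e3}"
  define X where "X = (\<lambda>e. if e = e1 then x1 else if e = e2 then x2 else x3)"
  have X [simp]: "X e1 = x1" "X e2 = x2" "X e3 = x3" using dist by (auto simp: X_def)
  let ?t = "trees (insert u V) (E \<union> ?A) en"
  note sumA = sum_Pow_triple[OF dist]
  have t: "?t (Z \<union> S0) = (\<Sum>S\<in>Pow ?A. of_bool (S0 \<subseteq> S \<and> S \<noteq> {}) * (\<Sum>D\<in>fam Z (card S). cb {X ` S} D))"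
    if "S0 \<subseteq> ?A" "Z \<subseteq> E" for S0 Z
    by (rule trees_star[OF u]) (use that E en x in auto)
  define m where "m Z = (SOME m. (\<Sum>S0\<in>Pow ?A. of_bool (?t (Z \<union> S0) = 0)) = 4 * m \<and>
     of_nat m = ntree Z + (1 + ntree Z) * (nsep x1 x2 x3 Z + nsep x2 x1 x3 Z + nsep x3 x1 x2 Z))" for Z
  have m: "(\<Sum>S0\<in>Pow ?A. of_bool (?t (Z \<union> S0) = 0)) = 4 * m Z"
    "of_nat (m Z) = ntree Z + (1 + ntree Z) * (nsep x1 x2 x3 Z + nsep x2 x1 x3 Z + nsep x3 x1 x2 Z)"
    if Z: "Z \<subseteq> E" for Z
  proof -
    have w1: "(\<Sum>D\<in>fam Z (Suc 0). cb {} D) = ntree Z" by (simp add: ntree_def)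
    have w2: "(\<Sum>D\<in>fam Z (Suc (Suc 0)). cb {{x, y}} D) = npair x y Z" for x y
      by (simp add: npair_def numeral_2_eq_2)
    have w3: "(\<Sum>D\<in>fam Z (Suc (Suc (Suc 0))). cb {{x, y, z}} D) = ntriple x y z Z" for x y z
      by (simp add: ntriple_def numeral_3_eq_3)
    have P12: "npair x1 x2 Z = nsep x1 x2 x3 Z + nsep x2 x1 x3 Z" using npair_eq_nsep x by blast
    have P13: "npair x1 x3 Z = nsep x1 x2 x3 Z + nsep x3 x1 x2 Z"
      using npair_eq_nsep[of x1 x3 x2] x nsep_commute by metis
    have P23: "npair x2 x3 Z = nsep x2 x1 x3 Z + nsep x3 x1 x2 Z"
      using npair_eq_nsep[of x2 x3 x1] x nsep_commute by metis
    define \<tau> where "\<tau> S0 = ?t (Z \<union> S0)" for S0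
    have t': "\<tau> S0 = of_bool (S0 \<subseteq> {e1}) * ntree Z + of_bool (S0 \<subseteq> {e2}) * ntree Z +
        of_bool (S0 \<subseteq> {e3}) * ntree Z + of_bool (S0 \<subseteq> {e1, e2}) * npair x1 x2 Z +
        of_bool (S0 \<subseteq> {e1, e3}) * npair x1 x3 Z + of_bool (S0 \<subseteq> {e2, e3}) * npair x2 x3 Z +
        ntriple x1 x2 x3 Z" if S0: "S0 \<subseteq> ?A" for S0
      unfolding \<tau>_def t[OF S0 Z] sumA using dist S0 by (simp add: w1 w2 w3)
    have ts: "\<tau> {} = ntree Z + ntriple x1 x2 x3 Z"
      "\<tau> {e1} = ntree Z + npair x2 x3 Z + ntriple x1 x2 x3 Z"
      "\<tau> {e2} = ntree Z + npair x1 x3 Z + ntriple x1 x2 x3 Z"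
      "\<tau> {e3} = ntree Z + npair x1 x2 Z + ntriple x1 x2 x3 Z"
      "\<tau> {e1, e2} = npair x1 x2 Z + ntriple x1 x2 x3 Z"
      "\<tau> {e1, e3} = npair x1 x3 Z + ntriple x1 x2 x3 Z"
      "\<tau> {e2, e3} = npair x2 x3 Z + ntriple x1 x2 x3 Z"
      "\<tau> {e1, e2, e3} = ntriple x1 x2 x3 Z"
      using t' dist by (simp_all add: P12 P13 P23 ac_simps)
    have "(\<Sum>S0\<in>Pow ?A. of_bool (\<tau> S0 = 0)) =
      (of_bool (\<tau> {} = 0) + of_bool (\<tau> {e1} = 0) + of_bool (\<tau> {e2} = 0) +
       of_bool (\<tau> {e3} = 0) + of_bool (\<tau> {e1, e2} = 0) + of_bool (\<tau> {e1, e3} = 0) +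
       of_bool (\<tau> {e2, e3} = 0) + of_bool (\<tau> {e1, e2, e3} = 0) :: nat)"
      by (rule sumA)
    moreover have "ntree Z * ntriple x1 x2 x3 Z = (nsep x1 x2 x3 Z + nsep x2 x1 x3 Z) *
        (nsep x1 x2 x3 Z + nsep x3 x1 x2 Z) + nsep x1 x2 x3 Z"
      using dodgson[OF x Z] unfolding P12 P13 .
    note star_fibre[OF this]
    ultimately have "\<exists>m. (\<Sum>S0\<in>Pow ?A. of_bool (?t (Z \<union> S0) = 0)) = 4 * m \<and>
     of_nat m = ntree Z + (1 + ntree Z) * (nsep x1 x2 x3 Z + nsep x2 x1 x3 Z + nsep x3 x1 x2 Z)"
      unfolding \<tau>_def[symmetric] ts P12 P13 P23 by simp
    from someI_ex[OF this]
    show "(\<Sum>S0\<in>Pow ?A. of_bool (?t (Z \<union> S0) = 0)) = 4 * m Z"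
      "of_nat (m Z) = ntree Z + (1 + ntree Z) * (nsep x1 x2 x3 Z + nsep x2 x1 x3 Z + nsep x3 x1 x2 Z)"
      unfolding m_def by blast+
  qed
  have "zeros (insert u V) (E \<union> ?A) en = (\<Sum>S0\<in>Pow ?A. \<Sum>Z\<in>Pow E. of_bool (?t (Z \<union> S0) = 0))"
    unfolding zeros_def by (rule sum_Pow_Un) (use E in blast)
  also have "\<dots> = (\<Sum>Z\<in>Pow E. \<Sum>S0\<in>Pow ?A. of_bool (?t (Z \<union> S0) = 0))"
    by (rule sum.swap)
  also have "\<dots> = 4 * sum m (Pow E)"
    unfolding sum_distrib_left by (intro sum.cong refl) (use m(1) in blast)
  finally have "of_nat (zeros (insert u V) (E \<union> ?A) en div 4) = (\<Sum>Z\<in>Pow E. of_nat (m Z) :: bit)"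
    by simp
  also have "\<dots> = (\<Sum>Z\<in>Pow E. ntree Z + (nsep x1 x2 x3 Z + nsep x2 x1 x3 Z + nsep x3 x1 x2 Z) +
     ntree Z * (nsep x1 x2 x3 Z + nsep x2 x1 x3 Z + nsep x3 x1 x2 Z))"
    by (intro sum.cong refl) (simp add: m(2) distrib_right add.assoc)
  also have "\<dots> = nconf x1 x2 x3"
  proof -
    have "(\<Sum>Z\<in>Pow E. ntree Z) = 0" using sum_sum_fam[of 1] card by (simp add: ntree_def)
    moreover have "(\<Sum>Z\<in>Pow E. nsep x1 x2 x3 Z + nsep x2 x1 x3 Z + nsep x3 x1 x2 Z) = 0"
      unfolding nsep_total using sum_sum_fam[of 2] card by simp
    ultimately show ?thesis using sum_ntree_nsep[OF card(1), of x1 x2 x3] by (simp only: sum.distrib) simp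
  qed
  finally show ?thesis .
qed

section \<open>Partitions into a tree and a forest\<close>

text \<open>Connectivity requires at least \<open>card V - 1\<close> edges in \<open>T\<close> and
  \<open>card V - 2\<close> in its complement, which exhausts \<open>E\<close>. So both sizes are
  exact, and \<open>\<chi>\<close> is the indicator of one of the two components of the
  complement.\<close>

lemma partition_components:
  assumes card: "card E + 3 = 2 * card V" and T: "T \<subseteq> E" "cb {} T = 1"
    and r: "cb {r} (E - T) = 1" "\<exists>a b. r = {a, b}"
  shows "card T + 1 = card V" and "card (E - T) + 2 = card V"
    and "\<exists>\<chi>. (\<forall>e\<in>E - T. dif \<chi> (en e) = 0) \<and> (\<forall>e\<in>E. dif \<chi> (en e) = cb {en e} (E - T)) \<and>
      (\<forall>a\<in>V. \<forall>b\<in>V. cb {{a, b}} (E - T) = \<chi> a + \<chi> b)"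
proof -
  have fT: "finite T" using T finE finite_subset by blast
  have cET: "card T + card (E - T) = card E"
    using T finE fT by (simp add: card_Diff_subset card_mono)
  have "\<not> card (E - T) + card {r} + 1 < card V"
    using cb_eq_0[of "E - T" "{r}"] r by auto
  moreover have "\<not> card T + card ({}::'v set set) + 1 < card V"
    using cb_eq_0[of T "{}"] T by auto
  ultimately show 1: "card T + 1 = card V" and 2: "card (E - T) + 2 = card V"
    using cET card by simp_all
  have c: "conn V (insert r (en ` (E - T)))" using r by (simp add: cb_def split: if_splits)
  have n: "\<not> conn V (en ` (E - T))" using cb_eq_0[of "E - T" "{}"] 2 by (simp add: cb_def split: if_splits)
  have "\<exists>\<chi>. (\<forall>s\<in>en ` (E - T). dif \<chi> s = 0) \<and> dif \<chi> r = 1 \<and>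
    (\<forall>a\<in>V. \<forall>b\<in>V. conn V (insert {a, b} (en ` (E - T))) \<longleftrightarrow> \<chi> a \<noteq> \<chi> b)"
    by (rule two_components[OF c n r(2)]) (use en_pair in blast)
  then obtain \<chi> where \<chi>: "\<forall>s\<in>en ` (E - T). dif \<chi> s = 0"
    "\<forall>a\<in>V. \<forall>b\<in>V. conn V (insert {a, b} (en ` (E - T))) \<longleftrightarrow> \<chi> a \<noteq> \<chi> b" by blast
  have ab: "cb {{a, b}} (E - T) = \<chi> a + \<chi> b" if "a \<in> V" "b \<in> V" for a b
    using \<chi>(2) that by (cases "\<chi> a"; cases "\<chi> b") (auto simp: cb_def)
  have "dif \<chi> (en e) = cb {en e} (E - T)" if eE: "e \<in> E" for e
  proof -
    obtain a b where e: "en e = {a, b}" using en_pair[OF eE] by blast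
    then have "a \<in> V" "b \<in> V" using enV[OF eE] by auto
    then show ?thesis unfolding e dif_pair by (rule ab[symmetric])
  qed
  then show "\<exists>\<chi>. (\<forall>e\<in>E - T. dif \<chi> (en e) = 0) \<and> (\<forall>e\<in>E. dif \<chi> (en e) = cb {en e} (E - T)) \<and>
      (\<forall>a\<in>V. \<forall>b\<in>V. cb {{a, b}} (E - T) = \<chi> a + \<chi> b)"
    using \<chi>(1) ab by blast
qed

text \<open>The path from \<open>x\<close> to \<open>y\<close> in the tree \<open>T\<close> passes
  between the two components of \<open>E - T\<close> an odd number of times exactly if these
  separate \<open>x\<close> from \<open>y\<close>. If the complement has more components, both sides
  vanish.\<close>

lemma exchange_sum:
  assumes card: "card E + 3 = 2 * card V" and T: "T \<subseteq> E" "cb {} T = 1" and xy: "x \<in> V" "y \<in> V"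
  shows "(\<Sum>t\<in>T. cb {en t} (E - T) * cb {{x, y}} (T - {t})) = cb {{x, y}} (E - T)"
proof (cases "\<exists>r a b. cb {r} (E - T) = 1 \<and> r = {a, b}")
  case True
  then obtain r where r: "cb {r} (E - T) = 1" "\<exists>a b. r = {a, b}" by blast
  note pc = partition_components[OF card T r]
  obtain \<chi> where \<chi>: "\<And>e. e \<in> E \<Longrightarrow> dif \<chi> (en e) = cb {en e} (E - T)"
    "cb {{x, y}} (E - T) = \<chi> x + \<chi> y" using pc(3) xy by blast
  have "(\<Sum>t\<in>T. cb {{x, y}} (T - {t}) * dif \<chi> (en t)) = \<chi> x + \<chi> y"
    using edge_path_sum[of T "{}" x y \<chi>] T xy pc(1) by simp
  moreover have "(\<Sum>t\<in>T. cb {en t} (E - T) * cb {{x, y}} (T - {t})) = (\<Sum>t\<in>T. cb {{x, y}} (T - {t}) * dif \<chi> (en t))"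
    by (rule sum.cong) (use \<chi>(1) T in \<open>auto simp: mult.commute\<close>)
  ultimately show ?thesis using \<chi>(2) by simp
next
  case False
  then have "cb {{x, y}} (E - T) = 0" by auto
  moreover have "cb {en t} (E - T) = 0" if "t \<in> T" for t using False en_pair[of t] that T by auto
  ultimately show ?thesis by simp
qed

text \<open>The involution \<open>(T, F, t) \<mapsto> (F + t, T - t, t)\<close> matches the crossing edges \<open>t\<close> for which \<open>F\<close> but not
  \<open>T - t\<close> separates \<open>x\<close> and \<open>y\<close> with those for which \<open>T - t\<close> but not \<open>F\<close> does; by \<open>exchange_sum\<close> the latter
  are even in number for each partition.\<close>

lemma cross_parity:
  assumes card: "card E + 3 = 2 * card V" and xy: "x \<in> V" "y \<in> V"
  shows "(\<Sum>T\<in>Pow E. cb {} T * cb {{x, y}} (E - T) * (\<Sum>t\<in>T. cb {en t} (E - T))) =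
    (\<Sum>T\<in>Pow E. cb {} T * cb {{x, y}} (E - T))"
proof -
  have fT: "finite T" if "T \<in> Pow E" for T using that finE finite_subset by blast
  let ?g = "\<lambda>(T, t). cb {} T * cb {{x, y}} (E - T) * (cb {en t} (E - T) * (1 + cb {{x, y}} (T - {t})))"
  let ?h = "\<lambda>(T, t). cb {} T * (1 + cb {{x, y}} (E - T)) * (cb {en t} (E - T) * cb {{x, y}} (T - {t}))"
  \<comment> \<open>If \<open>E - T\<close> separates \<open>x\<close> from \<open>y\<close>, the
    crossing edges on the tree path are odd in number and give the first term; \<open>?g\<close>
    keeps the crossing edges off the path.\<close>
  have 1: "cb {} T * cb {{x, y}} (E - T) * (\<Sum>t\<in>T. cb {en t} (E - T)) =
    cb {} T * cb {{x, y}} (E - T) + (\<Sum>t\<in>T. ?g (T, t))" if T: "T \<in> Pow E" for T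
  proof -
    have "(\<Sum>t\<in>T. cb {en t} (E - T)) = (\<Sum>t\<in>T. cb {en t} (E - T) * cb {{x, y}} (T - {t})) +
      (\<Sum>t\<in>T. cb {en t} (E - T) * (1 + cb {{x, y}} (T - {t})))"
      unfolding sum.distrib[symmetric] by (rule sum.cong) (auto simp: distrib_left ac_simps)
    moreover have "cb {} T * cb {{x, y}} (E - T) * (\<Sum>t\<in>T. cb {en t} (E - T) * cb {{x, y}} (T - {t})) =
      cb {} T * cb {{x, y}} (E - T)"
      using exchange_sum[OF card _ _ xy, of T] T by (cases "cb {} T"; cases "cb {{x, y}} (E - T)") auto
    ultimately show ?thesis by (simp add: distrib_left sum_distrib_left)
  qed
  have "(\<Sum>T\<in>Pow E. \<Sum>t\<in>T. ?g (T, t)) = sum ?g (SIGMA T:Pow E. T)"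
    using sum.Sigma[of "Pow E" "\<lambda>T. T" "\<lambda>T t. ?g (T, t)"] fT finE by simp
  also have "\<dots> = sum ?h (SIGMA T:Pow E. T)"
  proof (rule sum.reindex_bij_witness[where i = "\<lambda>(T, t). (insert t (E - T), t)" and j = "\<lambda>(T, t). (insert t (E - T), t)"])
    fix p assume "p \<in> (SIGMA T:Pow E. T)"
    then obtain T t where p: "p = (T, t)" "T \<subseteq> E" "t \<in> T" by blast
    have T: "E - insert t (E - T) = T - {t}" "insert t (T - {t}) = T" "insert t (E - T) - {t} = E - T"
      using p by auto
    show "(\<lambda>(T, t). (insert t (E - T), t)) ((\<lambda>(T, t). (insert t (E - T), t)) p) = p"
      "(\<lambda>(T, t). (insert t (E - T), t)) ((\<lambda>(T, t). (insert t (E - T), t)) p) = p"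
      using p(1) T by auto
    show "(\<lambda>(T, t). (insert t (E - T), t)) p \<in> (SIGMA T:Pow E. T)" "(\<lambda>(T, t). (insert t (E - T), t)) p \<in> (SIGMA T:Pow E. T)"
      using p by auto
    \<comment> \<open>The exchange turns the condition that \<open>T\<close> is connected into the
      condition that \<open>t\<close> crosses, and conversely.\<close>
    have "cb {en t} (T - {t}) = cb {} T" using cb_insert_edge[of "{}" t "T - {t}"] T by simp
    then show "?h ((\<lambda>(T, t). (insert t (E - T), t)) p) = ?g p"
      using p(1) T by (simp add: cb_insert_edge ac_simps)
  qed
  also have "\<dots> = (\<Sum>T\<in>Pow E. \<Sum>t\<in>T. ?h (T, t))"
    using sum.Sigma[of "Pow E" "\<lambda>T. T" "\<lambda>T t. ?h (T, t)"] fT finE by simp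
  also have "\<dots> = 0"
  proof (rule sum.neutral, rule ballI)
    fix T assume T: "T \<in> Pow E"
    have "(\<Sum>t\<in>T. ?h (T, t)) = cb {} T * (1 + cb {{x, y}} (E - T)) *
       (\<Sum>t\<in>T. cb {en t} (E - T) * cb {{x, y}} (T - {t}))" by (simp add: sum_distrib_left)
    also have "\<dots> = 0"
      using exchange_sum[OF card _ _ xy, of T] T by (cases "cb {} T"; cases "cb {{x, y}} (E - T)") auto
    finally show "(\<Sum>t\<in>T. ?h (T, t)) = 0" .
  qed
  finally have 2: "(\<Sum>T\<in>Pow E. \<Sum>t\<in>T. ?g (T, t)) = 0" .
  have "(\<Sum>T\<in>Pow E. cb {} T * cb {{x, y}} (E - T) * (\<Sum>t\<in>T. cb {en t} (E - T))) =
     (\<Sum>T\<in>Pow E. cb {} T * cb {{x, y}} (E - T) + (\<Sum>t\<in>T. ?g (T, t)))"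
    by (rule sum.cong[OF refl 1])
  also have "\<dots> = (\<Sum>T\<in>Pow E. cb {} T * cb {{x, y}} (E - T)) + (\<Sum>T\<in>Pow E. \<Sum>t\<in>T. ?g (T, t))"
    by (rule sum.distrib)
  finally show ?thesis using 2 by simp
qed

text \<open>If the forest separates \<open>x\<close> from \<open>y\<close>, \<open>bal\<close>
  counts its crossing edges, modulo 2, as one plus the indicators that it separates
  \<open>b1\<close> from \<open>b2\<close> and \<open>d1\<close> from \<open>d2\<close>. By
  \<open>cross_parity\<close> the sum of these two indicators over all such partitions is
  even.\<close>

lemma balanced_pairs:
  assumes card: "card E + 3 = 2 * card V"
    and V: "x \<in> V" "y \<in> V" "b1 \<in> V" "b2 \<in> V" "d1 \<in> V" "d2 \<in> V"
    and bal: "\<And>\<chi>. (\<Sum>e\<in>E. dif \<chi> (en e)) = \<chi> x + \<chi> y + (\<chi> b1 + \<chi> b2) + (\<chi> d1 + \<chi> d2)"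
  shows "(\<Sum>T\<in>Pow E. cb {} T * (cb {{x, y}} (E - T) * (1 + cb {{b1, b2}} (E - T)))) =
    (\<Sum>T\<in>Pow E. cb {} T * (cb {{x, y}} (E - T) * (1 + cb {{d1, d2}} (E - T))))"
proof -
  \<comment> \<open>Modulo 2, \<open>1 + b + d\<close> equals \<open>1 + (1 + b) + (1 + d)\<close>,
    which brings in the summands of the two sides of the claim.\<close>
  have "cb {} T * cb {{x, y}} (E - T) * (\<Sum>t\<in>T. cb {en t} (E - T)) =
      cb {} T * cb {{x, y}} (E - T) + cb {} T * (cb {{x, y}} (E - T) * (1 + cb {{b1, b2}} (E - T))) +
      cb {} T * (cb {{x, y}} (E - T) * (1 + cb {{d1, d2}} (E - T)))" if T: "T \<in> Pow E" for T
  proof (cases "cb {} T = 1 \<and> cb {{x, y}} (E - T) = 1")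
    case True
    moreover have "\<exists>a b. {x, y} = {a, b}" by blast
    ultimately obtain \<chi> where \<chi>: "\<forall>e\<in>E - T. dif \<chi> (en e) = 0" "\<forall>e\<in>E. dif \<chi> (en e) = cb {en e} (E - T)"
      "\<forall>a\<in>V. \<forall>b\<in>V. cb {{a, b}} (E - T) = \<chi> a + \<chi> b"
      using partition_components(3)[OF card, of T "{x, y}"] T by blast
    have "(\<Sum>t\<in>T. cb {en t} (E - T)) = (\<Sum>t\<in>T. dif \<chi> (en t))"
      by (rule sum.cong) (use T \<chi>(2) in auto)
    \<comment> \<open>Edges of the forest do not cross, so the sum may run over all of
      \<open>E\<close>, where \<open>bal\<close> applies.\<close>
    also have "\<dots> = (\<Sum>t\<in>E. dif \<chi> (en t))"
      by (rule sum.mono_neutral_left) (use T \<chi>(1) finE in auto)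
    also have "\<dots> = 1 + cb {{b1, b2}} (E - T) + cb {{d1, d2}} (E - T)"
      proof -
      have "cb {{x, y}} (E - T) = \<chi> x + \<chi> y" "cb {{b1, b2}} (E - T) = \<chi> b1 + \<chi> b2"
        "cb {{d1, d2}} (E - T) = \<chi> d1 + \<chi> d2" using \<chi>(3) V by blast+
      then show ?thesis unfolding bal using True by simp
    qed
    finally show ?thesis using True
      by (cases "cb {{b1, b2}} (E - T)"; cases "cb {{d1, d2}} (E - T)") simp_all
  next
    case False
    then show ?thesis by auto
  qed
  then have "(\<Sum>T\<in>Pow E. cb {} T * cb {{x, y}} (E - T) * (\<Sum>t\<in>T. cb {en t} (E - T))) =
     (\<Sum>T\<in>Pow E. cb {} T * cb {{x, y}} (E - T)) +
     (\<Sum>T\<in>Pow E. cb {} T * (cb {{x, y}} (E - T) * (1 + cb {{b1, b2}} (E - T)))) +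
     (\<Sum>T\<in>Pow E. cb {} T * (cb {{x, y}} (E - T) * (1 + cb {{d1, d2}} (E - T))))"
    by (simp only: sum.distrib[symmetric] cong: sum.cong)
  moreover have "s = s + p + q \<Longrightarrow> p = q" for s p q :: bit by (cases s; cases p; cases q) simp_all
  ultimately show ?thesis unfolding cross_parity[OF card V(1,2)] by blast
qed

text \<open>If the forest separates \<open>b1\<close> from \<open>b2\<close>, both values of
  \<open>sep\<close> are 1 and cancel. Otherwise each says whether \<open>x\<close>, respectively
  \<open>y\<close>, is separated from that pair, and their sum says whether \<open>x\<close> and
  \<open>y\<close> are separated.\<close>

lemma sep_exchange:
  assumes card: "card E + 3 = 2 * card V" and T: "T \<subseteq> E"
    and V: "x \<in> V" "y \<in> V" "b1 \<in> V" "b2 \<in> V"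
  shows "cb {} T * (sep x b1 b2 (E - T) + sep y b1 b2 (E - T)) =
    cb {} T * (cb {{x, y}} (E - T) * (1 + cb {{b1, b2}} (E - T)))"
proof (cases "cb {} T = 1 \<and> (\<exists>r. cb {r} (E - T) = 1 \<and> (\<exists>a b. r = {a, b}))")
  case True
  then obtain r where "cb {r} (E - T) = 1" "\<exists>a b. r = {a, b}" by blast
  from partition_components(3)[OF card T _ this] True
  obtain \<chi> where \<chi>: "\<forall>a\<in>V. \<forall>b\<in>V. cb {{a, b}} (E - T) = \<chi> a + \<chi> b" by blast
  show ?thesis unfolding sep_def using V
    by (cases "\<chi> x"; cases "\<chi> y"; cases "\<chi> b1"; cases "\<chi> b2") (simp_all add: \<chi>)
next
  case False
  then have "cb {} T = 0 \<or> (\<forall>a b. cb {{a, b}} (E - T) = 0)" by auto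
  then show ?thesis by (auto simp: sep_def)
qed

section \<open>Removing a vertex with at most two edges from the partition count\<close>

text \<open>An isolated \<open>a\<close> is one component, and the rest has to be the other. Since
  \<open>b1\<close> and \<open>b2\<close> are not both \<open>a\<close>, the three vertices are then
  split.\<close>

lemma sep_isolated:
  assumes a: "a \<notin> V" and b: "b1 \<in> insert a V" "b2 \<in> insert a V" "b1 \<noteq> a \<or> b2 \<noteq> a" and D: "D \<subseteq> E"
    and K: "incidence (insert a V) E' en"
  shows "incidence.sep (insert a V) en a b1 b2 D = cb {} D"
proof -
  interpret K: incidence "insert a V" E' en by (rule K)
  obtain y where y: "y \<in> V" using neV by blast
  have r: "r \<subseteq> V" if "r \<in> en ` D" for r using that D enV by blast
  have 1: "K.cb {{a, b}} D = cb {} D" if "b \<in> V" for b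
    using conn_star[of a V "{b}" "en ` D"] that r a by (simp add: K.cb_def cb_def)
  have 2: "K.cb {{b, b'}} D = 0" if "b \<in> V" "b' \<in> V" for b b'
  proof -
    have "\<not> conn (insert a V) (insert {b, b'} (en ` D))"
      using y a that r by (intro not_conn_isolated[of a _ y]) auto
    then show ?thesis by (simp add: K.cb_def)
  qed
  have 3: "K.cb {} D = 0"
    using 2[OF y y] by simp
  have sq: "x * x = x" for x :: bit by (cases x) auto
  show ?thesis
    using b by (auto simp: K.sep_def 1 2 3 sq insert_commute)
qed

text \<open>The pendant vertex \<open>a\<close> lies in the component of its neighbour
  \<open>y\<close>, which can replace it.\<close>

lemma sep_pendant:
  assumes a: "a \<notin> V" and b: "b1 \<in> V" "b2 \<in> V" "y \<in> V" and D: "D \<subseteq> E" and e: "en e = {a, y}"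
    and K: "incidence (insert a V) E' en"
  shows "incidence.sep (insert a V) en a b1 b2 (insert e D) = sep y b1 b2 D"
proof -
  interpret K: incidence "insert a V" E' en by (rule K)
  have r: "r \<subseteq> V" if "r \<in> en ` D" for r using that D enV by blast
  have 1: "K.cb {{a, b}} (insert e D) = cb {{y, b}} D" if "b \<in> V" for b
  proof -
    have "{{a, b}} \<union> en ` insert e D = en ` D \<union> (\<lambda>x. {a, x}) ` {y, b}"
      using e by auto
    then show ?thesis
      using conn_star[of a V "{y, b}" "en ` D"] that r a assms(4) by (auto simp: K.cb_def cb_def)
  qed
  have 2: "K.cb {{b, b'}} (insert e D) = cb {{b, b'}} D" if "b \<in> V" "b' \<in> V" for b b'
  proof -
    have "{{b, b'}} \<union> en ` insert e D = insert {b, b'} (en ` D) \<union> (\<lambda>x. {a, x}) ` {y}"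
      using e by auto
    moreover have "r \<subseteq> V" if "r \<in> insert {b, b'} (en ` D)" for r
      using that r \<open>b \<in> V\<close> \<open>b' \<in> V\<close> by blast
    then have "conn (insert a V) (insert {b, b'} (en ` D) \<union> (\<lambda>x. {a, x}) ` {y}) =
        conn V (insert {y} (insert {b, b'} (en ` D)))"
      using a assms(4) by (intro conn_star) auto
    ultimately show ?thesis by (simp add: K.cb_def cb_def)
  qed
  show ?thesis using b by (simp add: K.sep_def sep_def 1 2)
qed

lemma nconf_deg0:
  assumes "a \<in> V" "y \<in> V" "y \<noteq> a" "\<And>e. e \<in> E \<Longrightarrow> a \<notin> en e"
  shows "nconf x1 x2 x3 = 0"
  unfolding nconf_def
proof (rule sum.neutral, rule ballI)
  fix T assume "T \<in> Pow E"
  then have "\<not> conn V (en ` T)" using assms by (intro not_conn_isolated[of a _ y]) auto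
  then show "cb {} T * sep x1 x2 x3 (E - T) = 0" by (simp add: cb_def)
qed

lemma cb_pendant:
  assumes "a \<notin> V" "y \<in> V" "D \<subseteq> E" "en e = {a, y}" and K: "incidence (insert a V) E' en"
  shows "incidence.cb (insert a V) en {} (insert e D) = cb {} D"
proof -
  interpret K: incidence "insert a V" E' en by (rule K)
  have r: "r \<subseteq> V" if "r \<in> en ` D" for r using that assms enV by blast
  show ?thesis
    using conn_star[of a V "{y}" "en ` D"] r assms by (simp add: K.cb_def cb_def)
qed

lemma cb_isolated:
  assumes "a \<notin> V" "D \<subseteq> E" and K: "incidence (insert a V) E' en"
  shows "incidence.cb (insert a V) en {} D = 0"
proof -
  interpret K: incidence "insert a V" E' en by (rule K)
  obtain y where y: "y \<in> V" using neV by blast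
  have "\<not> conn (insert a V) (en ` D)"
    using y assms enV by (intro not_conn_isolated[of a _ y]) auto
  then show ?thesis by (simp add: K.cb_def)
qed

text \<open>The tree must use the only edge at \<open>a\<close>, so \<open>a\<close> is isolated in
  the forest, and a partition into two spanning trees remains. The result no longer depends on
  \<open>b1\<close> and \<open>b2\<close>.\<close>

lemma nconf_deg1:
  assumes a: "a \<notin> V" and e: "e \<notin> E" "en e = {a, y}" "y \<in> V"
    and b: "b1 \<in> insert a V" "b2 \<in> insert a V" "b1 \<noteq> a \<or> b2 \<noteq> a"
    and K: "incidence (insert a V) (E \<union> {e}) en"
  shows "incidence.nconf (insert a V) (E \<union> {e}) en a b1 b2 = (\<Sum>T\<in>Pow E. cb {} T * cb {} (E - T))"
proof -
  interpret K: incidence "insert a V" "E \<union> {e}" en by (rule K)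
  have "K.nconf a b1 b2 = (\<Sum>S\<in>Pow {e}. \<Sum>T\<in>Pow E. K.cb {} (T \<union> S) * K.sep a b1 b2 ((E \<union> {e}) - (T \<union> S)))"
    unfolding K.nconf_def by (rule sum_Pow_Un) (use e in auto)
  also have "\<dots> = (\<Sum>T\<in>Pow E. K.cb {} T * K.sep a b1 b2 ((E \<union> {e}) - T)) +
     (\<Sum>T\<in>Pow E. K.cb {} (insert e T) * K.sep a b1 b2 ((E \<union> {e}) - insert e T))"
    by (simp add: Pow_insert)
  also have "(\<Sum>T\<in>Pow E. K.cb {} T * K.sep a b1 b2 ((E \<union> {e}) - T)) = 0"
    using cb_isolated[OF a _ K] by (intro sum.neutral) auto
  also have "(\<Sum>T\<in>Pow E. K.cb {} (insert e T) * K.sep a b1 b2 ((E \<union> {e}) - insert e T)) =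
     (\<Sum>T\<in>Pow E. cb {} T * cb {} (E - T))"
  proof (rule sum.cong[OF refl])
    fix T assume T: "T \<in> Pow E"
    have "(E \<union> {e}) - insert e T = E - T" using e by auto
    then show "K.cb {} (insert e T) * K.sep a b1 b2 ((E \<union> {e}) - insert e T) = cb {} T * cb {} (E - T)"
      using cb_pendant[OF a e(3) _ e(2) K] sep_isolated[OF a b _ K] T by auto
  qed
  finally show ?thesis by simp
qed

text \<open>If both edges at \<open>a\<close> belong to the tree, \<open>a\<close> is isolated in
  the forest, and the tree without \<open>a\<close> is a forest separating \<open>y\<close> from
  \<open>y'\<close>; this part is independent of \<open>b1\<close> and \<open>b2\<close>. If each
  side has one of the edges, \<open>a\<close> is pendant in both and is replaced by \<open>y\<close>
  or \<open>y'\<close> in the forest; \<open>sep_exchange\<close> combines the two cases.\<close>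

lemma nconf_deg2:
  assumes a: "a \<notin> V" and e: "e \<notin> E" "e' \<notin> E" "e \<noteq> e'" "en e = {a, y}" "en e' = {a, y'}" "y \<in> V" "y' \<in> V"
    and b: "b1 \<in> V" "b2 \<in> V" and card: "card E + 3 = 2 * card V"
    and K: "incidence (insert a V) (E \<union> {e, e'}) en"
  shows "incidence.nconf (insert a V) (E \<union> {e, e'}) en a b1 b2 =
    (\<Sum>T\<in>Pow E. cb {{y, y'}} T * cb {} (E - T)) +
    (\<Sum>T\<in>Pow E. cb {} T * (cb {{y, y'}} (E - T) * (1 + cb {{b1, b2}} (E - T))))"
proof -
  interpret K: incidence "insert a V" "E \<union> {e, e'}" en by (rule K)
  let ?E = "E \<union> {e, e'}"
  have b': "b1 \<in> insert a V" "b2 \<in> insert a V" "b1 \<noteq> a \<or> b2 \<noteq> a" using b a by auto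
  have P: "Pow {e, e'} = {{}, {e}, {e'}, {e, e'}}" by (auto simp: Pow_insert)
  have ne: "{e} \<noteq> {e, e'}" "{e'} \<noteq> {e, e'}" "{e} \<noteq> {e'}" using e by auto
  have "K.nconf a b1 b2 = (\<Sum>S\<in>Pow {e, e'}. \<Sum>T\<in>Pow E. K.cb {} (T \<union> S) * K.sep a b1 b2 (?E - (T \<union> S)))"
    unfolding K.nconf_def by (rule sum_Pow_Un) (use e in auto)
  also have "\<dots> = (\<Sum>T\<in>Pow E. K.cb {} T * K.sep a b1 b2 (?E - T)) +
     (\<Sum>T\<in>Pow E. K.cb {} (insert e T) * K.sep a b1 b2 (?E - insert e T)) +
     (\<Sum>T\<in>Pow E. K.cb {} (insert e' T) * K.sep a b1 b2 (?E - insert e' T)) +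
     (\<Sum>T\<in>Pow E. K.cb {} (insert e (insert e' T)) * K.sep a b1 b2 (?E - insert e (insert e' T)))"
    unfolding P using ne by (simp add: add.assoc)
  also have "(\<Sum>T\<in>Pow E. K.cb {} T * K.sep a b1 b2 (?E - T)) = 0"
    using cb_isolated[OF a _ K] by (intro sum.neutral) auto
  also have "(\<Sum>T\<in>Pow E. K.cb {} (insert e T) * K.sep a b1 b2 (?E - insert e T)) =
     (\<Sum>T\<in>Pow E. cb {} T * sep y' b1 b2 (E - T))"
  proof (rule sum.cong[OF refl])
    fix T assume T: "T \<in> Pow E"
    have "?E - insert e T = insert e' (E - T)" using e T by auto
    then show "K.cb {} (insert e T) * K.sep a b1 b2 (?E - insert e T) = cb {} T * sep y' b1 b2 (E - T)"
      using cb_pendant[OF a e(6) _ e(4) K] sep_pendant[OF a b e(7) _ e(5) K] T by auto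
  qed
  also have "(\<Sum>T\<in>Pow E. K.cb {} (insert e' T) * K.sep a b1 b2 (?E - insert e' T)) =
     (\<Sum>T\<in>Pow E. cb {} T * sep y b1 b2 (E - T))"
  proof (rule sum.cong[OF refl])
    fix T assume T: "T \<in> Pow E"
    have "?E - insert e' T = insert e (E - T)" using e T by auto
    then show "K.cb {} (insert e' T) * K.sep a b1 b2 (?E - insert e' T) = cb {} T * sep y b1 b2 (E - T)"
      using cb_pendant[OF a e(7) _ e(5) K] sep_pendant[OF a b e(6) _ e(4) K] T by auto
  qed
  also have "(\<Sum>T\<in>Pow E. K.cb {} (insert e (insert e' T)) * K.sep a b1 b2 (?E - insert e (insert e' T))) =
     (\<Sum>T\<in>Pow E. cb {{y, y'}} T * cb {} (E - T))"
  proof (rule sum.cong[OF refl])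
    fix T assume T: "T \<in> Pow E"
    have "?E - insert e (insert e' T) = E - T" using e T by auto
    moreover have "K.cb {} (insert e (insert e' T)) = cb {{y, y'}} T"
      using conn_star[of a V "{y, y'}" "en ` T"] enV T a e
      by (auto simp: K.cb_def cb_def)
    ultimately show "K.cb {} (insert e (insert e' T)) * K.sep a b1 b2 (?E - insert e (insert e' T)) =
       cb {{y, y'}} T * cb {} (E - T)"
      using sep_isolated[OF a b' _ K] by auto
  qed
  finally have "K.nconf a b1 b2 = (\<Sum>T\<in>Pow E. cb {{y, y'}} T * cb {} (E - T)) +
     (\<Sum>T\<in>Pow E. cb {} T * (sep y b1 b2 (E - T) + sep y' b1 b2 (E - T)))"
    by (simp add: sum.distrib distrib_left ac_simps)
  also have "(\<Sum>T\<in>Pow E. cb {} T * (sep y b1 b2 (E - T) + sep y' b1 b2 (E - T))) =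
    (\<Sum>T\<in>Pow E. cb {} T * (cb {{y, y'}} (E - T) * (1 + cb {{b1, b2}} (E - T))))"
    by (rule sum.cong[OF refl]) (use sep_exchange[OF card] e b in auto)
  finally show ?thesis .
qed

text \<open>Complementation swaps the two trees and changes which of them contains the edge
  \<open>e\<close>, so the partitions come in pairs.\<close>

lemma sum_two_trees:
  assumes "E \<noteq> {}"
  shows "(\<Sum>T\<in>Pow E. cb {} T * cb {} (E - T)) = 0"
proof -
  obtain e where e: "e \<in> E" using assms by blast
  let ?f = "\<lambda>T. cb {} T * cb {} (E - T)"
  let ?A = "{T\<in>Pow E. e \<in> T}" and ?B = "{T\<in>Pow E. e \<notin> T}"
  have "sum ?f (Pow E) = sum ?f ?A + sum ?f ?B"
  proof -
    have P: "Pow E = ?A \<union> ?B" by blast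
    have "sum ?f (?A \<union> ?B) = sum ?f ?A + sum ?f ?B"
      by (rule sum.union_disjoint) (use finE in auto)
    then show ?thesis by (subst P)
  qed
  moreover have "sum ?f ?A = sum ?f ?B"
    by (rule sum.reindex_bij_witness[where i = "\<lambda>T. E - T" and j = "\<lambda>T. E - T"])
       (use e in \<open>auto simp: double_diff mult.commute\<close>)
  ultimately show ?thesis by simp
qed

section \<open>Two adjacent vertices of degree two\<close>

text \<open>The edges \<open>p\<close>, \<open>q\<close>, \<open>r\<close> form a path from
  \<open>z'\<close> through \<open>w\<close> and \<open>a\<close> to \<open>z\<close>. Omitting at
  least two of them cuts off \<open>w\<close> or \<open>a\<close>, omitting one leaves pendant
  pieces, and the whole path acts like an edge between \<open>z\<close> and
  \<open>z'\<close>.\<close>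

lemma conn_chain:
  assumes w: "w \<notin> insert a V" "a \<notin> V" and z: "z \<in> V" "z' \<in> V" and D: "D \<subseteq> E"
    and en: "en p = {w, z'}" "en q = {w, a}" "en r = {a, z}"
  defines "c \<equiv> \<lambda>S. (of_bool (conn (insert w (insert a V)) (en ` (D \<union> S))) :: bit)"
  shows "c {} = 0" "c {p} = 0" "c {q} = 0" "c {r} = 0" "c {p, q} = cb {} D" "c {p, r} = cb {} D"
    "c {q, r} = cb {} D" "c {p, q, r} = cb {{z, z'}} D"
proof -
  let ?R = "en ` D" and ?R' = "insert {a, z} (en ` D)"
  have DV: "\<And>r. r \<in> ?R \<Longrightarrow> r \<subseteq> V" using D enV by blast
  then have R: "\<And>r. r \<in> ?R \<Longrightarrow> r \<subseteq> insert a V" "\<And>r. r \<in> ?R' \<Longrightarrow> r \<subseteq> insert a V" using z by blast+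
  have W1: "\<not> conn (insert w (insert a V)) ?R" "\<not> conn (insert w (insert a V)) ?R'"
    using R w by (intro not_conn_isolated[of w _ a]; blast)+
  have Wp: "conn (insert w (insert a V)) (insert {w, z'} R) = conn (insert a V) R"
    if "\<And>r. r \<in> R \<Longrightarrow> r \<subseteq> insert a V" for R
    using conn_star[of w "insert a V" "{z'}" R] w z that by simp
  have Wq: "conn (insert w (insert a V)) (insert {w, a} R) = conn (insert a V) R"
    if "\<And>r. r \<in> R \<Longrightarrow> r \<subseteq> insert a V" for R
    using conn_star[of w "insert a V" "{a}" R] w that by simp
  have Wpq: "conn (insert w (insert a V)) (insert {w, z'} (insert {w, a} R)) = conn (insert a V) (insert {a, z'} R)"
    if "\<And>r. r \<in> R \<Longrightarrow> r \<subseteq> insert a V" for R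
    using conn_star[of w "insert a V" "{z', a}" R] w z that by (simp add: insert_commute)
  have A0: "\<not> conn (insert a V) ?R"
    using DV w z by (intro not_conn_isolated[of a _ z]; blast)
  have A1: "conn (insert a V) (insert {a, y} ?R) = conn V ?R" if "y \<in> V" for y
    using conn_star[of a V "{y}" ?R] w that DV by simp
  have A2: "conn (insert a V) (insert {a, z'} ?R') = conn V (insert {z, z'} ?R)"
    using conn_star[of a V "{z', z}" ?R] w z DV by (simp add: insert_commute)
  show "c {} = 0" "c {p} = 0" "c {q} = 0" "c {r} = 0"
    using W1 Wp[of ?R, OF R(1)] Wq[of ?R, OF R(1)] A0 by (auto simp: c_def en)
  have "c {p, q} = of_bool (conn (insert w (insert a V)) (insert {w, z'} (insert {w, a} ?R)))"
    by (simp add: c_def en)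
  then show "c {p, q} = cb {} D" using Wpq[of ?R, OF R(1)] A1[OF z(2)] by (simp add: cb_def)
  have "c {p, r} = of_bool (conn (insert w (insert a V)) (insert {w, z'} ?R'))"
    by (simp add: c_def en)
  then show "c {p, r} = cb {} D" using Wp[of ?R', OF R(2)] A1[OF z(1)] by (simp add: cb_def)
  have "c {q, r} = of_bool (conn (insert w (insert a V)) (insert {w, a} ?R'))"
    by (simp add: c_def en)
  then show "c {q, r} = cb {} D" using Wq[of ?R', OF R(2)] A1[OF z(1)] by (simp add: cb_def)
  have "c {p, q, r} = of_bool (conn (insert w (insert a V)) (insert {w, z'} (insert {w, a} ?R')))"
    by (simp add: c_def en)
  then show "c {p, q, r} = cb {{z, z'}} D" using Wpq[of ?R', OF R(2)] A2 by (simp add: cb_def)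
qed

text \<open>Only the sum of the three variables on the path matters, and each value of it is attained
  four times.\<close>

lemma zeros_chain:
  assumes w: "w \<notin> insert a V" "a \<notin> V" and z: "z \<in> V" "z' \<in> V"
    and en: "en p = {w, z'}" "en q = {w, a}" "en r = {a, z}"
    and dist: "p \<noteq> q" "p \<noteq> r" "q \<noteq> r" and E: "p \<notin> E" "q \<notin> E" "r \<notin> E" and card: "2 \<le> card V"
  shows "of_nat (zeros (insert w (insert a V)) (E \<union> {p, q, r}) en div 4) = (0 :: bit)"
proof -
  let ?A = "{p, q, r}"
  let ?t = "trees (insert w (insert a V)) (E \<union> ?A) en"
  define \<tau> where "\<tau> Z S0 = ?t (Z \<union> S0)" for Z S0
  define N where "N = npair z z'"
  have t: "\<tau> Z S0 = of_bool (S0 \<subseteq> {p, q}) * ntree Z + of_bool (S0 \<subseteq> {p, r}) * ntree Z +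
      of_bool (S0 \<subseteq> {q, r}) * ntree Z + N Z" if Z: "Z \<subseteq> E" and S0: "S0 \<subseteq> ?A" for Z S0
  proof -
    let ?c = "\<lambda>S D. (of_bool (conn (insert w (insert a V)) (en ` (D \<union> S))) :: bit)"
    define W where "W S = (\<Sum>D\<in>Pow E. of_bool (Z \<subseteq> D \<and> card D + card S = card V + 1) * ?c S D)" for S
    have "\<tau> Z S0 = (\<Sum>S\<in>Pow ?A. \<Sum>D\<in>Pow E. of_bool (Z \<union> S0 \<subseteq> D \<union> S \<and>
        card (D \<union> S) + 1 = card (insert w (insert a V)) \<and> conn (insert w (insert a V)) (en ` (D \<union> S))))"
      unfolding \<tau>_def trees_def by (rule sum_Pow_Un) (use E in blast)
    also have "\<dots> = (\<Sum>S\<in>Pow ?A. of_bool (S0 \<subseteq> S) * W S)"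
      unfolding W_def sum_distrib_left
    proof (intro sum.cong refl)
      fix S D assume S: "S \<in> Pow ?A" and D: "D \<in> Pow E"
      then have fin: "finite S" "finite D" using finE finite_subset[of S ?A] finite_subset[of D E] by auto
      have disj: "D \<inter> S = {}" using S D E by blast
      have 1: "Z \<union> S0 \<subseteq> D \<union> S \<longleftrightarrow> Z \<subseteq> D \<and> S0 \<subseteq> S" using S D E S0 Z by blast
      have 2: "card (D \<union> S) + 1 = card (insert w (insert a V)) \<longleftrightarrow> card D + card S = card V + 1"
        using fin disj w finV by (simp add: card_Un_disjoint)
      show "of_bool (Z \<union> S0 \<subseteq> D \<union> S \<and> card (D \<union> S) + 1 = card (insert w (insert a V)) \<and>
          conn (insert w (insert a V)) (en ` (D \<union> S))) =
        of_bool (S0 \<subseteq> S) * (of_bool (Z \<subseteq> D \<and> card D + card S = card V + 1) * ?c S D)"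
        unfolding 1 2 of_bool_conj by (simp only: ac_simps)
    qed
    also have "\<dots> = of_bool (S0 \<subseteq> {p, q}) * ntree Z + of_bool (S0 \<subseteq> {p, r}) * ntree Z +
      of_bool (S0 \<subseteq> {q, r}) * ntree Z + N Z"
    proof -
      have 0: "W S = 0"
        if "S = {} \<or> S = {p} \<or> S = {q} \<or> S = {r}" for S
        using conn_chain(1-4)[OF w z _ en] that unfolding W_def by (intro sum.neutral) auto
      have 1: "W S = ntree Z"
        if S: "S = {p, q} \<or> S = {p, r} \<or> S = {q, r}" for S
      proof -
        have "card S = 2" using S dist by auto
        moreover have "?c S D = cb {} D" if "D \<in> Pow E" for D
          using conn_chain(5-7)[OF w z _ en, of D] that S by blast
        ultimately show ?thesis unfolding W_def ntree_def sum_fam by (intro sum.cong) auto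
      qed
      have 2: "W {p, q, r} = N Z"
      proof -
        have "card {p, q, r} = 3" using dist by auto
        moreover have "?c {p, q, r} D = cb {{z, z'}} D" if "D \<in> Pow E" for D
          using conn_chain(8)[OF w z _ en, of D] that by blast
        ultimately show ?thesis unfolding W_def N_def npair_def sum_fam by (intro sum.cong) auto
      qed
      show ?thesis
        unfolding sum_Pow_triple[OF dist] using S0 0 1 2 by simp
    qed
    finally show ?thesis .
  qed
  have \<tau>: "\<tau> Z {} = ntree Z + N Z" "\<tau> Z {p} = N Z" "\<tau> Z {q} = N Z" "\<tau> Z {r} = N Z"
    "\<tau> Z {p, q} = ntree Z + N Z" "\<tau> Z {p, r} = ntree Z + N Z" "\<tau> Z {q, r} = ntree Z + N Z"
    "\<tau> Z {p, q, r} = N Z" if "Z \<subseteq> E" for Z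
    using t[OF that] dist by simp_all
  \<comment> \<open>An even number of vanishing path variables gives the value
    \<open>ntree Z + N Z\<close>, an odd number gives \<open>N Z\<close>; each occurs at four of the
    eight points.\<close>
  define m :: "'e set \<Rightarrow> nat" where "m Z = of_bool (N Z = 0) + of_bool (ntree Z + N Z = 0)" for Z
  have "zeros (insert w (insert a V)) (E \<union> ?A) en = (\<Sum>S0\<in>Pow ?A. \<Sum>Z\<in>Pow E. of_bool (\<tau> Z S0 = 0))"
    unfolding zeros_def \<tau>_def by (rule sum_Pow_Un) (use E in blast)
  also have "\<dots> = (\<Sum>Z\<in>Pow E. \<Sum>S0\<in>Pow ?A. of_bool (\<tau> Z S0 = 0))"
    by (rule sum.swap)
  also have "\<dots> = (\<Sum>Z\<in>Pow E. 4 * m Z)"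
    by (rule sum.cong[OF refl]) (simp add: sum_Pow_triple[OF dist] \<tau> m_def)
  also have "\<dots> = 4 * sum m (Pow E)" by (rule sum_distrib_left[symmetric])
  finally have "of_nat (zeros (insert w (insert a V)) (E \<union> ?A) en div 4) = (\<Sum>Z\<in>Pow E. of_nat (m Z) :: bit)"
    by simp
  also have "\<dots> = (\<Sum>Z\<in>Pow E. ntree Z)"
  proof (rule sum.cong[OF refl])
    fix Z
    \<comment> \<open>The two values coincide if \<open>ntree Z = 0\<close>; otherwise exactly one
      of them vanishes.\<close>
    show "of_nat (m Z) = ntree Z"
      unfolding m_def by (cases "N Z"; cases "ntree Z") simp_all
  qed
  also have "\<dots> = 0" using sum_sum_fam[of 1] card by (simp add: ntree_def)
  finally show ?thesis .
qed

end

section \<open>The point count of the graph polynomial\<close>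

lemma of_int_bit_eq_0_iff: "(of_int x :: bit) = 0 \<longleftrightarrow> even x"
  by (cases "even x") (auto elim!: evenE oddE)

lemma of_nat_bit_eq_0_iff: "(of_nat n :: bit) = 0 \<longleftrightarrow> even n"
  by (cases "even n") (auto elim!: evenE oddE)

lemma of_nat_bit_eqD: "(of_nat m :: bit) = of_nat n \<Longrightarrow> m mod 2 = n mod 2"
  using of_nat_bit_eq_0_iff[of m] of_nat_bit_eq_0_iff[of n] by (metis even_iff_mod_2_eq_zero odd_iff_mod_2_eq_one)

section \<open>Spanning trees as connecting sets with the right number of edges\<close>

text \<open>A step back to a vertex already visited truncates the list there. Distinct vertices are
  what \<open>is_cycle\<close> asks for.\<close>

lemma rtranclp_distinct_path:
  assumes "r\<^sup>*\<^sup>* x y"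
  shows "\<exists>xs. xs \<noteq> [] \<and> xs ! 0 = x \<and> last xs = y \<and> distinct xs \<and> (\<forall>i. Suc i < length xs \<longrightarrow> r (xs ! i) (xs ! Suc i))"
  using assms
proof (induction rule: rtranclp_induct)
  case base
  show ?case by (intro exI[of _ "[x]"]) auto
next
  case (step y z)
  then obtain xs where xs: "xs \<noteq> []" "xs ! 0 = x" "last xs = y" "distinct xs"
    "\<And>i. Suc i < length xs \<Longrightarrow> r (xs ! i) (xs ! Suc i)" by blast
  show ?case
  proof (cases "z \<in> set xs")
    case True
    then obtain k where k: "k < length xs" "xs ! k = z" by (auto simp: in_set_conv_nth)
    have "last (take (Suc k) xs) = z" using k by (simp add: take_Suc_conv_app_nth)
    then show ?thesis
      using k xs by (intro exI[of _ "take (Suc k) xs"]) auto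
  next
    case False
    have "last xs = xs ! (length xs - 1)" using xs by (simp add: last_conv_nth)
    then have "r (xs ! i) z" if "Suc i = length xs" for i
      using that step.hyps(2) xs(3) by (metis diff_Suc_1)
    then show ?thesis
      using False xs by (intro exI[of _ "xs @ [z]"]) (auto simp: nth_append less_Suc_eq)
  qed
qed

text \<open>A potential without differences on edges is constant along walks; conversely, the
  indicator of the vertices reachable from \<open>x\<close> is such a potential.\<close>

lemma connected_graph_iff_conn:
  fixes H :: "('v, 'e) mgraph"
  assumes "\<And>e. e \<in> edges H \<Longrightarrow> \<exists>a b. ends H e = {a, b}"
  shows "connected_graph H \<longleftrightarrow> verts H \<noteq> {} \<and> conn (verts H) (ends H ` edges H)"
proof (intro iffI conjI)
  assume c: "connected_graph H"
  then show "verts H \<noteq> {}" by (simp add: connected_graph_def)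
  show "conn (verts H) (ends H ` edges H)"
    unfolding conn_def
  proof (intro allI impI ballI)
    fix \<psi> :: "'v \<Rightarrow> bit" and a b
    assume \<psi>: "\<forall>r\<in>ends H ` edges H. dif \<psi> r = 0" and ab: "a \<in> verts H" "b \<in> verts H"
    have "(adjacent H)\<^sup>*\<^sup>* a b" using c ab by (simp add: connected_graph_def)
    then show "\<psi> a = \<psi> b"
    proof (induction rule: rtranclp_induct)
      case (step y z)
      then obtain e where "e \<in> edges H" "ends H e = {y, z}" unfolding adjacent_def by blast
      then have "dif \<psi> {y, z} = 0" using \<psi> by force
      then show ?case using step by (simp add: bit_add_eq_0_iff)
    qed simp
  qed
next
  assume c: "verts H \<noteq> {} \<and> conn (verts H) (ends H ` edges H)"
  have "(adjacent H)\<^sup>*\<^sup>* x y" if xy: "x \<in> verts H" "y \<in> verts H" for x y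
  proof -
    let ?\<psi> = "\<lambda>z. of_bool ((adjacent H)\<^sup>*\<^sup>* x z) :: bit"
    have "dif ?\<psi> r = 0" if "r \<in> ends H ` edges H" for r
    proof -
      from that obtain e where e: "e \<in> edges H" "r = ends H e" by blast
      then obtain a b where ab: "r = {a, b}" using assms by blast
      then have "adjacent H a b" "adjacent H b a"
        using e unfolding adjacent_def by (auto simp: insert_commute)
      then have "(adjacent H)\<^sup>*\<^sup>* x a \<longleftrightarrow> (adjacent H)\<^sup>*\<^sup>* x b"
        by (meson rtranclp.rtrancl_into_rtrancl)
      then show ?thesis unfolding ab by simp
    qed
    then have "?\<psi> x = ?\<psi> y" using connD[OF conjunct2[OF c], of ?\<psi> x y] xy by blast
    then show ?thesis by (auto split: if_splits)
  qed
  then show "connected_graph H" using c by (simp add: connected_graph_def)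
qed

lemma cycle_imp_redundant:
  fixes H :: "('v, 'e) mgraph"
  assumes "is_cycle H xs es" and c: "conn (verts H) (ends H ` edges H)"
  shows "\<exists>e\<in>edges H. conn (verts H) (ends H ` (edges H - {e}))"
proof -
  define n where "n = length es - 1"
  have es: "length es = Suc n" "length xs = Suc n" "distinct es" "set es \<subseteq> edges H"
    "\<And>i. i < Suc n \<Longrightarrow> ends H (es ! i) = {xs ! i, xs ! (Suc i mod Suc n)}"
    using assms(1) unfolding is_cycle_def n_def by auto
  have "conn (verts H) (ends H ` (edges H - {es ! n}))"
    unfolding conn_def
  proof (intro allI impI)
    fix \<psi> :: "'v \<Rightarrow> bit" assume \<psi>: "\<forall>r\<in>ends H ` (edges H - {es ! n}). dif \<psi> r = 0"
    have eq: "\<psi> (xs ! i) = \<psi> (xs ! 0)" if "i \<le> n" for i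
      using that
    proof (induction i)
      case (Suc i)
      then have i: "i < n" by simp
      then have "es ! i \<noteq> es ! n" using es by (simp add: nth_eq_iff_index_eq)
      moreover have "es ! i \<in> edges H" using es(1,4) i nth_mem[of i es] by auto
      ultimately have "dif \<psi> (ends H (es ! i)) = 0" using \<psi> by blast
      then have "\<psi> (xs ! i) = \<psi> (xs ! Suc i)" using es(5)[of i] i by (simp add: bit_add_eq_0_iff)
      then show ?case using Suc i by simp
    qed simp
    have "dif \<psi> (ends H (es ! n)) = 0" using es(5)[of n] eq[of n] by (simp add: bit_add_eq_0_iff)
    then have "dif \<psi> r = 0" if "r \<in> ends H ` edges H" for r using \<psi> that by blast
    then show "\<forall>a\<in>verts H. \<forall>b\<in>verts H. \<psi> a = \<psi> b" using connD[OF c, of \<psi>] by blast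
  qed
  moreover have "es ! n \<in> edges H" using es(1,4) nth_mem[of n es] by auto
  ultimately show ?thesis by blast
qed

text \<open>A path between the ends of \<open>e\<close> that avoids \<open>e\<close> is closed to a
  cycle by \<open>e\<close>; if the path is a single parallel edge, the cycle has length 2.\<close>

lemma redundant_imp_cycle:
  fixes H :: "('v, 'e) mgraph"
  assumes wf: "\<And>e. e \<in> edges H \<Longrightarrow> ends H e \<subseteq> verts H \<and> card (ends H e) = 2"
    and e: "e \<in> edges H" and c: "conn (verts H) (ends H ` (edges H - {e}))"
  shows "\<exists>xs es. is_cycle H xs es"
proof -
  let ?H = "H\<lparr>edges := edges H - {e}\<rparr>"
  obtain x y where xy: "ends H e = {x, y}" "x \<noteq> y" using wf[OF e] by (meson card_2_iff)
  then have V: "x \<in> verts H" "y \<in> verts H" using wf[OF e] by auto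
  have "connected_graph ?H"
  proof -
    have "\<exists>a b. ends H f = {a, b}" if "f \<in> edges H" for f using wf[OF that] by (meson card_2_iff)
    then show ?thesis using c V connected_graph_iff_conn[of ?H] by auto
  qed
  then have "(adjacent ?H)\<^sup>*\<^sup>* x y" using V by (simp add: connected_graph_def)
  from rtranclp_distinct_path[OF this] obtain xs where xs: "xs \<noteq> []" "xs ! 0 = x" "last xs = y" "distinct xs"
    "\<And>i. Suc i < length xs \<Longrightarrow> adjacent ?H (xs ! i) (xs ! Suc i)" by blast
  define n where "n = length xs - 1"
  have len: "length xs = Suc n" and lst: "xs ! n = y" using xs by (auto simp: n_def last_conv_nth)
  have "\<exists>f. f \<in> edges H - {e} \<and> ends H f = {xs ! i, xs ! Suc i}" if "i < n" for i
    using xs(5)[of i] that len unfolding adjacent_def by auto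
  then obtain g where g: "\<And>i. i < n \<Longrightarrow> g i \<in> edges H - {e} \<and> ends H (g i) = {xs ! i, xs ! Suc i}"
    by metis
  define es where "es = map g [0..<n] @ [e]"
  have nth: "es ! i = (if i < n then g i else e)" if "i < Suc n" for i
    using that by (auto simp: es_def nth_append less_Suc_eq)
  have ends: "ends H (es ! i) = {xs ! i, xs ! (Suc i mod Suc n)}" if "i < Suc n" for i
  proof (cases "i < n")
    case True
    then show ?thesis using g[OF True] nth[OF that] by simp
  next
    case False
    then have "i = n" using that by simp
    then show ?thesis using nth[of n] xy(1) xs(2) lst by (simp add: insert_commute)
  qed
  have "inj_on g {0..<n}"
  proof (rule inj_onI)
    fix i j assume ij: "i \<in> {0..<n}" "j \<in> {0..<n}" "g i = g j"
    then have "{xs ! i, xs ! Suc i} = {xs ! j, xs ! Suc j}" using g[of i] g[of j] by auto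
    then show "i = j" using ij xs(4) len by (auto simp: doubleton_eq_iff nth_eq_iff_index_eq)
  qed
  moreover have "e \<notin> g ` {0..<n}" using g by fastforce
  ultimately have "distinct es" unfolding es_def by (simp add: distinct_map)
  moreover have "set es \<subseteq> edges H" using g e by (auto simp: es_def)
  moreover have "set xs \<subseteq> verts H"
  proof
    fix z assume "z \<in> set xs"
    then obtain i where i: "i < Suc n" "xs ! i = z" using len by (auto simp: in_set_conv_nth)
    then have "z \<in> ends H (es ! i)" using ends by auto
    moreover have "es ! i \<in> edges H" using i nth g e by auto
    ultimately show "z \<in> verts H" using wf by blast
  qed
  ultimately have "is_cycle H xs es"
    using xs(4) len ends by (auto simp: is_cycle_def es_def)
  then show ?thesis by blast
qed

lemma spanning_tree_iff:
  fixes H :: "('v, 'e) mgraph"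
  assumes wf: "wf_mgraph H" and ne: "verts H \<noteq> {}"
  shows "spanning_tree H T \<longleftrightarrow> T \<subseteq> edges H \<and> card T + 1 = card (verts H) \<and> conn (verts H) (ends H ` T)"
proof (cases "T \<subseteq> edges H \<and> conn (verts H) (ends H ` T)")
  case False
  have "spanning_tree H T \<Longrightarrow> T \<subseteq> edges H \<and> conn (verts H) (ends H ` T)"
  proof -
    assume s: "spanning_tree H T"
    then have T: "T \<subseteq> edges H" by (simp add: spanning_tree_def)
    have "connected_graph (H\<lparr>edges := T\<rparr>)" using s by (simp add: spanning_tree_def is_tree_def)
    moreover have "\<exists>a b. ends H e = {a, b}" if "e \<in> T" for e
      using wf T that unfolding wf_mgraph_def by (meson card_2_iff subset_iff)
    ultimately show ?thesis using T connected_graph_iff_conn[of "H\<lparr>edges := T\<rparr>"] by simp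
  qed
  then show ?thesis using False by blast
next
  case True
  then have T: "T \<subseteq> edges H" and c: "conn (verts H) (ends H ` T)" by auto
  let ?H = "H\<lparr>edges := T\<rparr>"
  have fin: "finite (verts H)" "finite T" using wf T finite_subset unfolding wf_mgraph_def by blast+
  have e2: "ends H e \<subseteq> verts H \<and> card (ends H e) = 2" if "e \<in> T" for e
    using wf T that unfolding wf_mgraph_def by blast
  then have pair: "\<exists>a b. ends H e = {a, b}" if "e \<in> T" for e using that by (meson card_2_iff)
  have "connected_graph ?H" using connected_graph_iff_conn[of ?H] pair c ne by simp
  moreover have "(\<exists>xs es. is_cycle ?H xs es) \<longleftrightarrow> (\<exists>e\<in>T. conn (verts H) (ends H ` (T - {e})))"
    using cycle_imp_redundant[of ?H] redundant_imp_cycle[of ?H] c e2 by fastforce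
  moreover have "(\<forall>e\<in>T. \<not> conn (verts H) (ends H ` (T - {e}))) \<longleftrightarrow> card T + 1 = card (verts H)"
  proof
    assume min: "\<forall>e\<in>T. \<not> conn (verts H) (ends H ` (T - {e}))"
    \<comment> \<open>The counts concern sets of ends, so parallel edges are excluded first: one of
      two could be dropped.\<close>
    have inj: "inj_on (ends H) T"
    proof (rule inj_onI, rule ccontr)
      fix e e' assume e: "e \<in> T" "e' \<in> T" "ends H e = ends H e'" "e \<noteq> e'"
      then have "ends H ` (T - {e}) = ends H ` T" by auto
      then show False using min c e by metis
    qed
    have "\<not> conn (verts H) (ends H ` T - {r})" if r: "r \<in> ends H ` T" for r
    proof
      assume a: "conn (verts H) (ends H ` T - {r})"
      obtain e where "e \<in> T" "r = ends H e" using r by blast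
      then have "ends H ` T - {r} \<subseteq> ends H ` (T - {e})" by auto
      then show False using min conn_mono[OF a] \<open>e \<in> T\<close> by blast
    qed
    then have "card (ends H ` T) + 1 \<le> card (verts H)"
      using fin ne c e2 pair by (intro card_le_of_minimal_conn) auto
    moreover have "card (verts H) \<le> card (ends H ` T) + 1"
      by (rule conn_card_le) (use fin ne c pair in auto)
    ultimately show "card T + 1 = card (verts H)" using card_image[OF inj] by simp
  next
    assume card: "card T + 1 = card (verts H)"
    show "\<forall>e\<in>T. \<not> conn (verts H) (ends H ` (T - {e}))"
    proof (intro ballI notI)
      fix e assume e: "e \<in> T" and a: "conn (verts H) (ends H ` (T - {e}))"
      have "card (verts H) \<le> card (ends H ` (T - {e})) + 1"
        by (rule conn_card_le) (use fin ne a pair in auto)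
      moreover have "card (ends H ` (T - {e})) \<le> card (T - {e})" using fin by (intro card_image_le) auto
      moreover have "card (T - {e}) < card T" using e fin by (intro card_Diff1_less) auto
      ultimately show False using card by linarith
    qed
  qed
  ultimately show ?thesis using T c by (auto simp: spanning_tree_def is_tree_def)
qed

lemma point_count_eq_zeros:
  fixes H :: "('v, 'e) mgraph"
  assumes wf: "wf_mgraph H" and ne: "verts H \<noteq> {}"
  shows "point_count 2 H = zeros (verts H) (edges H) (ends H)"
proof -
  let ?E = "edges H" and ?t = "trees (verts H) (edges H) (ends H)"
  have finE: "finite ?E" using wf by (simp add: wf_mgraph_def)
  have Psi: "[Psi H \<alpha> = 0] (mod int 2) \<longleftrightarrow> ?t {e\<in>?E. \<alpha> e = 0} = 0" if \<alpha>: "\<alpha> \<in> ?E \<rightarrow>\<^sub>E {0..<int 2}" for \<alpha>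
  proof -
    let ?Z = "{e\<in>?E. \<alpha> e = 0}"
    have 01: "\<alpha> e = 0 \<or> \<alpha> e = 1" if "e \<in> ?E" for e
    proof -
      have "\<alpha> e \<in> {0..<int 2}" using \<alpha> that by (rule PiE_mem)
      then show ?thesis by auto
    qed
    have prod: "(\<Prod>e\<in>?E - T. \<alpha> e) = of_bool (?Z \<subseteq> T)" for T
    proof (cases "?Z \<subseteq> T")
      case True
      have "(\<Prod>e\<in>?E - T. \<alpha> e) = (\<Prod>e\<in>?E - T. 1)"
        by (rule prod.cong) (use True 01 in auto)
      then show ?thesis using True by simp
    next
      case False
      then have "\<exists>e\<in>?E - T. \<alpha> e = 0" by blast
      then show ?thesis using False finE by (simp add: prod_zero_iff)
    qed
    have "of_int (Psi H \<alpha>) = (\<Sum>T | spanning_tree H T. of_bool (?Z \<subseteq> T) :: bit)"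
      unfolding Psi_def prod by simp
    also have "\<dots> = ?t ?Z"
      unfolding trees_def by (rule sum.mono_neutral_cong_left) (auto simp: finE spanning_tree_iff[OF wf ne])
    finally show ?thesis
      by (simp add: cong_0_iff of_int_bit_eq_0_iff[symmetric])
  qed
  have "bij_betw (\<lambda>\<alpha>. {e\<in>?E. \<alpha> e = 0}) {\<alpha> \<in> ?E \<rightarrow>\<^sub>E {0..<int 2}. [Psi H \<alpha> = 0] (mod int 2)} {Z\<in>Pow ?E. ?t Z = 0}"
  \<comment> \<open>The inverse map sends \<open>Z\<close> to the indicator of its complement,
    extensional on the edges.\<close>
  proof (rule bij_betw_byWitness[where f' = "\<lambda>Z. \<lambda>e\<in>?E. of_bool (e \<notin> Z)"])
    show "\<forall>\<alpha>\<in>{\<alpha> \<in> ?E \<rightarrow>\<^sub>E {0..<int 2}. [Psi H \<alpha> = 0] (mod int 2)}. (\<lambda>e\<in>?E. of_bool (e \<notin> {e\<in>?E. \<alpha> e = 0})) = \<alpha>"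
    proof
      fix \<alpha> assume "\<alpha> \<in> {\<alpha> \<in> ?E \<rightarrow>\<^sub>E {0..<int 2}. [Psi H \<alpha> = 0] (mod int 2)}"
      then have \<alpha>: "\<alpha> \<in> ?E \<rightarrow>\<^sub>E {0..<int 2}" by blast
      show "(\<lambda>e\<in>?E. of_bool (e \<notin> {e\<in>?E. \<alpha> e = 0})) = \<alpha>"
      proof
        fix e
        show "(\<lambda>e\<in>?E. of_bool (e \<notin> {e\<in>?E. \<alpha> e = 0})) e = \<alpha> e"
        proof (cases "e \<in> ?E")
          case True
          then have "\<alpha> e \<in> {0..<int 2}" using \<alpha> by (rule PiE_mem[rotated])
          then show ?thesis using True by auto
        next
          case False
          then show ?thesis using PiE_arb[OF \<alpha> False] by simp
        qed
      qed
    qed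
    show inv: "\<forall>Z\<in>{Z\<in>Pow ?E. ?t Z = 0}. {e\<in>?E. (\<lambda>e\<in>?E. of_bool (e \<notin> Z)) e = (0::int)} = Z" by auto
    show "(\<lambda>\<alpha>. {e\<in>?E. \<alpha> e = 0}) ` {\<alpha> \<in> ?E \<rightarrow>\<^sub>E {0..<int 2}. [Psi H \<alpha> = 0] (mod int 2)} \<subseteq> {Z\<in>Pow ?E. ?t Z = 0}"
      using Psi by auto
    show "(\<lambda>Z. \<lambda>e\<in>?E. of_bool (e \<notin> Z)) ` {Z\<in>Pow ?E. ?t Z = 0} \<subseteq> {\<alpha> \<in> ?E \<rightarrow>\<^sub>E {0..<int 2}. [Psi H \<alpha> = 0] (mod int 2)}"
    proof
      fix \<alpha> :: "'e \<Rightarrow> int" assume "\<alpha> \<in> (\<lambda>Z. \<lambda>e\<in>?E. of_bool (e \<notin> Z)) ` {Z\<in>Pow ?E. ?t Z = 0}"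
      then obtain Z where Z: "Z \<in> {Z\<in>Pow ?E. ?t Z = 0}" "\<alpha> = (\<lambda>e\<in>?E. of_bool (e \<notin> Z))" by blast
      have "\<alpha> \<in> ?E \<rightarrow>\<^sub>E {0..<int 2}" unfolding Z(2) by auto
      moreover have "{e\<in>?E. \<alpha> e = 0} = Z" using inv Z by blast
      ultimately show "\<alpha> \<in> {\<alpha> \<in> ?E \<rightarrow>\<^sub>E {0..<int 2}. [Psi H \<alpha> = 0] (mod int 2)}" using Psi Z by auto
    qed
  qed
  then have "point_count 2 H = card {Z\<in>Pow ?E. ?t Z = 0}"
    unfolding point_count_def using bij_betw_same_card by blast
  also have "\<dots> = zeros (verts H) ?E (ends H)"
    unfolding zeros_def using finE by (simp add: of_bool_def sum.If_cases Int_def)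
  finally show ?thesis .
qed

lemma c2_eqI:
  fixes H H' :: "('v, 'e) mgraph"
  assumes "wf_mgraph H" "verts H \<noteq> {}" "wf_mgraph H'" "verts H' \<noteq> {}"
    and "(of_nat (zeros (verts H) (edges H) (ends H) div 4) :: bit) =
      of_nat (zeros (verts H') (edges H') (ends H') div 4)"
  shows "c2 2 H = c2 2 H'"
  using of_nat_bit_eqD[OF assms(5)] point_count_eq_zeros[OF assms(1,2)] point_count_eq_zeros[OF assms(3,4)]
  by (simp add: c2_def)

section \<open>Four-regular graphs\<close>

locale four_regular = incidence V E en
  for V :: "'v set" and E :: "'e set" and en :: "'e \<Rightarrow> 'v set" +
  assumes degree4: "x \<in> V \<Longrightarrow> card {e\<in>E. x \<in> en e} = 4"
begin

section \<open>Edge sets at the vertices and their sizes\<close>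

definition inc :: "'v \<Rightarrow> 'e set" where
  "inc x = {e\<in>E. x \<in> en e}"

definition bt :: "'v \<Rightarrow> 'v \<Rightarrow> 'e set" where
  "bt x y = {e\<in>E. en e = {x, y}}"

text \<open>For \<open>X = {v}\<close> this is the edge set of the graph with \<open>v\<close>
  deleted.\<close>

definition av :: "'v set \<Rightarrow> 'e set" where
  "av X = {e\<in>E. en e \<inter> X = {}}"

lemma card_inc: "x \<in> V \<Longrightarrow> card (inc x) = 4"
  using degree4 by (simp add: inc_def)

lemma fin [simp]: "finite (inc x)" "finite (bt x y)" "finite (av X)"
  by (simp_all add: inc_def bt_def av_def finE)

lemma bt_commute: "bt x y = bt y x"
  by (simp add: bt_def insert_commute)

lemma bt_subset: "bt x y \<subseteq> inc x"
  by (auto simp: bt_def inc_def)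

lemma bt_disjoint: "y \<noteq> z \<Longrightarrow> bt x y \<inter> bt x z = {}"
  by (auto simp: bt_def doubleton_eq_iff)

lemma bt_neq: "bt x y \<noteq> {} \<Longrightarrow> x \<noteq> y"
  using en2 by (force simp: bt_def)

lemma other_end:
  assumes "e \<in> inc u"
  shows "\<exists>x\<in>V. x \<noteq> u \<and> en e = {u, x}"
proof -
  have e: "e \<in> E" "u \<in> en e" using assms by (auto simp: inc_def)
  obtain a b where ab: "en e = {a, b}" "a \<noteq> b" using en2[OF e(1)] by (meson card_2_iff)
  then have "a \<in> V" "b \<in> V" using enV[OF e(1)] by auto
  then show ?thesis using ab e(2) by (cases "u = a") (auto simp: insert_commute)
qed

lemma inc_Int: "v \<noteq> u \<Longrightarrow> inc v \<inter> inc u = bt v u"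
proof
  assume ne: "v \<noteq> u"
  show "inc v \<inter> inc u \<subseteq> bt v u"
  proof
    fix e assume e: "e \<in> inc v \<inter> inc u"
    then obtain x where "en e = {v, x}" using other_end by blast
    then show "e \<in> bt v u" using e ne by (auto simp: inc_def bt_def)
  qed
qed (auto simp: inc_def bt_def)

lemma card_inc_eq_sum:
  assumes "x \<in> V"
  shows "4 = (\<Sum>y\<in>V - {x}. card (bt x y))"
proof -
  have "inc x = (\<Union>y\<in>V - {x}. bt x y)"
  proof
    show "inc x \<subseteq> (\<Union>y\<in>V - {x}. bt x y)"
      using other_end by (fastforce simp: bt_def inc_def)
  qed (use bt_subset in blast)
  moreover have "card (\<Union>y\<in>V - {x}. bt x y) = (\<Sum>y\<in>V - {x}. card (bt x y))"
    using bt_disjoint finV by (intro card_UN_disjoint) auto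
  ultimately show ?thesis using card_inc[OF assms] by simp
qed

lemma sub_incidence:
  assumes "V - X \<noteq> {}"
  shows "incidence (V - X) (av X) en"
  using assms finV finE enV en2 by unfold_locales (auto simp: av_def)

text \<open>Every \<open>\<chi> z\<close> occurs once for each of the four edges at
  \<open>z\<close>, so an even number of times.\<close>

lemma handshake: "(\<Sum>e\<in>E. dif \<chi> (en e)) = 0"
proof -
  have "(\<Sum>e\<in>E. dif \<chi> (en e)) = (\<Sum>e\<in>E. \<Sum>z\<in>V. of_bool (z \<in> en e) * \<chi> z)"
  proof (rule sum.cong[OF refl])
    fix e assume e: "e \<in> E"
    obtain a b where ab: "en e = {a, b}" "a \<noteq> b" using en2[OF e] by (meson card_2_iff)
    have "(\<Sum>z\<in>V. of_bool (z \<in> en e) * \<chi> z) = (\<Sum>z\<in>{a, b}. \<chi> z)"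
      using enV[OF e] ab finV by (intro sum.mono_neutral_cong_right) auto
    then show "dif \<chi> (en e) = (\<Sum>z\<in>V. of_bool (z \<in> en e) * \<chi> z)" using ab by simp
  qed
  also have "\<dots> = (\<Sum>z\<in>V. \<Sum>e\<in>E. of_bool (z \<in> en e) * \<chi> z)" by (rule sum.swap)
  also have "\<dots> = 0"
  proof (rule sum.neutral, rule ballI)
    fix z assume z: "z \<in> V"
    have "(\<Sum>e\<in>E. of_bool (z \<in> en e)) = (of_nat (card {e\<in>E. z \<in> en e}) :: bit)"
      using finE by (simp add: of_bool_def sum.If_cases Int_def)
    then have "(\<Sum>e\<in>E. of_bool (z \<in> en e)) = (0 :: bit)" using degree4[OF z] by simp
    then show "(\<Sum>e\<in>E. of_bool (z \<in> en e) * \<chi> z) = 0" by (simp only: sum_distrib_right[symmetric]) simp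
  qed
  finally show ?thesis .
qed

lemma card_edges: "card E = 2 * card V"
proof -
  have "2 * card E = (\<Sum>e\<in>E. card (en e))" using en2 by simp
  also have "\<dots> = (\<Sum>e\<in>E. \<Sum>z\<in>V. of_bool (z \<in> en e))"
  proof (rule sum.cong[OF refl])
    fix e assume "e \<in> E"
    then have "V \<inter> {z. z \<in> en e} = en e" using enV by blast
    then show "card (en e) = (\<Sum>z\<in>V. of_bool (z \<in> en e))"
      using finV by (simp add: of_bool_def sum.If_cases)
  qed
  also have "\<dots> = (\<Sum>z\<in>V. \<Sum>e\<in>E. of_bool (z \<in> en e))" by (rule sum.swap)
  also have "\<dots> = (\<Sum>z\<in>V. 4)"
    by (rule sum.cong[OF refl]) (use finE degree4 in \<open>simp add: of_bool_def sum.If_cases Int_def\<close>)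
  finally show ?thesis by simp
qed

text \<open>Seven edges meet \<open>v\<close> or \<open>u\<close>, and two vertices fewer lower
  \<open>2 * card V\<close> by 4. This is the edge count at which a tree and a forest with two
  components fill the graph.\<close>

lemma card_avoid2:
  assumes "v \<in> V" "u \<in> V" "v \<noteq> u" "card (bt v u) = 1" "4 \<le> card V"
  shows "card (av {v, u}) + 3 = 2 * card (V - {v, u})"
proof -
  have "E = av {v, u} \<union> (inc v \<union> inc u)" "av {v, u} \<inter> (inc v \<union> inc u) = {}"
    by (auto simp: av_def inc_def)
  then have "card E = card (av {v, u}) + card (inc v \<union> inc u)"
    by (metis card_Un_disjoint fin(1,3) finite_UnI)
  moreover have "card (inc v \<union> inc u) + card (bt v u) = 8"
    using card_Un_Int[of "inc v" "inc u"] card_inc assms inc_Int by simp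
  moreover have "card (V - {v, u}) = card V - 2"
    using assms finV by (subst card_Diff_subset) auto
  ultimately show ?thesis using card_edges assms by linarith
qed

text \<open>After deletion of \<open>v\<close> the vertex \<open>u\<close> has three edges left, so
  \<open>zeros_star\<close> applies; \<open>5 \<le> card V\<close> leaves the three vertices that it
  asks for. The role of \<open>u\<close> is played by the other end of the given edge, and later
  also by the common neighbour.\<close>

lemma zeros_delete:
  assumes "v \<in> V" "u \<in> V" "v \<noteq> u" "card (bt v u) = 1" "5 \<le> card V"
    and e: "inc u - bt v u = {e1, e2, e3}" "e1 \<noteq> e2" "e1 \<noteq> e3" "e2 \<noteq> e3"
    and en: "en e1 = {u, x1}" "en e2 = {u, x2}" "en e3 = {u, x3}"
  shows "of_nat (zeros (V - {v}) (av {v}) en div 4) = incidence.nconf (V - {v, u}) (av {v, u}) en x1 x2 x3"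
    and "x1 \<in> V - {v, u}" "x2 \<in> V - {v, u}" "x3 \<in> V - {v, u}"
proof -
  have c: "card (V - {v, u}) = card V - 2" using assms finV by (subst card_Diff_subset) auto
  then have "card (V - {v, u}) \<noteq> 0" using assms by simp
  then have "V - {v, u} \<noteq> {}" by (metis card.empty)
  then interpret K: incidence "V - {v, u}" "av {v, u}" en by (rule sub_incidence)
  have x: "x \<in> V - {v, u}" if x: "f \<in> {e1, e2, e3}" "en f = {u, x}" for f x
  proof -
    have f: "f \<in> inc u" "f \<notin> bt v u" using x(1) e(1) by blast+
    then have "f \<in> E" by (simp add: inc_def)
    then have "x \<in> V" "x \<noteq> u" using enV[of f] en2[of f] x(2) by auto
    moreover have "x \<noteq> v" using f(2) \<open>f \<in> E\<close> x(2) by (auto simp: bt_def insert_commute)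
    ultimately show ?thesis by simp
  qed
  show xs: "x1 \<in> V - {v, u}" "x2 \<in> V - {v, u}" "x3 \<in> V - {v, u}"
    using x en by blast+
  have "av {v} = av {v, u} \<union> (inc u - bt v u)"
    using inc_Int[OF \<open>v \<noteq> u\<close>] by (auto simp: av_def inc_def)
  then have av: "av {v} = av {v, u} \<union> {e1, e2, e3}" using e(1) by simp
  have V: "V - {v} = insert u (V - {v, u})" using assms by blast
  have "e1 \<notin> av {v, u}" "e2 \<notin> av {v, u}" "e3 \<notin> av {v, u}"
    using en by (auto simp: av_def)
  then show "of_nat (zeros (V - {v}) (av {v}) en div 4) = K.nconf x1 x2 x3"
    unfolding V av
    by (intro K.zeros_star) (use e en xs assms c card_avoid2 in auto)
qed

lemma card_inc_minus:
  assumes "u \<in> V" "x \<noteq> y"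
  shows "card (inc u - bt u x - bt u y) + card (bt u x) + card (bt u y) = 4"
proof -
  have "card (inc u - (bt u x \<union> bt u y)) = card (inc u) - card (bt u x \<union> bt u y)"
    using bt_subset by (intro card_Diff_subset) auto
  moreover have "card (bt u x \<union> bt u y) = card (bt u x) + card (bt u y)"
    using bt_disjoint[OF assms(2)] by (intro card_Un_disjoint) auto
  moreover have "card (bt u x \<union> bt u y) \<le> card (inc u)"
    using bt_subset by (intro card_mono) auto
  moreover have eq: "inc u - bt u x - bt u y = inc u - (bt u x \<union> bt u y)" by blast
  ultimately show ?thesis unfolding eq using card_inc[OF assms(1)] by linarith
qed

lemma av_triple: "v \<noteq> w \<Longrightarrow> a \<noteq> v \<Longrightarrow> a \<noteq> w \<Longrightarrow> av {v, w} = av {v, w, a} \<union> (inc a - bt a v - bt a w)"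
  using inc_Int[of a v] inc_Int[of a w] by (auto simp: av_def inc_def)

lemma star_edges:
  assumes "u \<in> V" "card (bt v u) = 1" and e1: "e1 \<in> inc u - bt v u"
  shows "\<exists>e2 e3 x2 x3. inc u - bt v u = {e1, e2, e3} \<and> e1 \<noteq> e2 \<and> e1 \<noteq> e3 \<and> e2 \<noteq> e3 \<and>
    en e2 = {u, x2} \<and> en e3 = {u, x3}"
proof -
  have "card (inc u - bt v u) = 3"
    using card_Diff_subset[of "bt v u" "inc u"] card_inc[OF assms(1)] assms(2) bt_subset bt_commute by force
  then have "card ((inc u - bt v u) - {e1}) = 2" using e1 by simp
  then obtain e2 e3 where e: "(inc u - bt v u) - {e1} = {e2, e3}" "e2 \<noteq> e3" by (meson card_2_iff)
  then have "e2 \<in> inc u" "e3 \<in> inc u" by blast+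
  then obtain x2 x3 where "en e2 = {u, x2}" "en e3 = {u, x3}" using other_end by meson
  moreover have "inc u - bt v u = {e1, e2, e3}" "e1 \<noteq> e2" "e1 \<noteq> e3" using e e1 by blast+
  ultimately show ?thesis using e(2) by blast
qed

lemma rest_end:
  assumes "e \<in> inc a - bt a v - bt a w"
  shows "\<exists>y\<in>V - {v, w, a}. en e = {a, y}"
proof -
  obtain y where y: "y \<in> V" "y \<noteq> a" "en e = {a, y}" using assms other_end by blast
  moreover have "e \<in> E" using assms by (simp add: inc_def)
  ultimately have "y \<noteq> v" "y \<noteq> w" using assms by (auto simp: bt_def)
  then show ?thesis using y by blast
qed

section \<open>Comparing the two deletions\<close>

text \<open>Both sides become \<open>nconf\<close> of the graph without \<open>v\<close> and
  \<open>w\<close>, with the common neighbour \<open>a\<close> as first vertex. With no edge left at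
  \<open>a\<close> both vanish, with one both count partitions into two trees, and with two
  \<open>nconf_deg2\<close> and \<open>balanced_pairs\<close> compare them.\<close>

lemma zeros_delete_simple:
  assumes V: "v \<in> V" "w \<in> V" "a \<in> V" and vw: "card (bt v w) = 1" and va: "bt v a \<noteq> {}" and wa: "bt w a \<noteq> {}"
    and n: "5 \<le> card V"
  shows "(of_nat (zeros (V - {v}) (av {v}) en div 4) :: bit) = of_nat (zeros (V - {w}) (av {w}) en div 4)"
proof -
  have "bt v w \<noteq> {}" using vw by auto
  then have ne: "v \<noteq> w" "a \<noteq> v" "a \<noteq> w" using bt_neq va wa by metis+
  obtain e1 where e1: "e1 \<in> bt w a" using wa by blast
  then have "e1 \<in> inc w - bt v w" using ne by (auto simp: bt_def inc_def doubleton_eq_iff)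
  from star_edges[OF V(2) vw this] obtain e2 e3 b1 b2 where
    e: "inc w - bt v w = {e1, e2, e3}" "e1 \<noteq> e2" "e1 \<noteq> e3" "e2 \<noteq> e3"
    and ene: "en e1 = {w, a}" "en e2 = {w, b1}" "en e3 = {w, b2}" using e1 by (auto simp: bt_def)
  note zv = zeros_delete[OF V(1,2) ne(1) vw n e ene]
  have wv: "card (bt w v) = 1" using vw bt_commute by metis
  obtain f1 where f1: "f1 \<in> bt v a" using va by blast
  then have "f1 \<in> inc v - bt w v" using ne by (auto simp: bt_def inc_def doubleton_eq_iff)
  from star_edges[OF V(1) wv this] obtain f2 f3 d1 d2 where
    f: "inc v - bt w v = {f1, f2, f3}" "f1 \<noteq> f2" "f1 \<noteq> f3" "f2 \<noteq> f3"
    and enf: "en f1 = {v, a}" "en f2 = {v, d1}" "en f3 = {v, d2}" using f1 by (auto simp: bt_def)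
  note zw = zeros_delete[OF V(2,1) ne(1)[symmetric] wv n f enf]
  have wv_vw: "{w, v} = {v, w}" by blast
  let ?I = "inc a - bt a v - bt a w"
  have cI: "card ?I + card (bt a v) + card (bt a w) = 4" using card_inc_minus[OF V(3) ne(1)] .
  have pos: "card (bt a v) \<ge> 1" "card (bt a w) \<ge> 1"
    using va wa bt_commute[of a] by (auto simp: Suc_le_eq card_gt_0_iff)
  have card3: "card (V - {v, w, a}) = card V - 3" using V ne finV by (subst card_Diff_subset) auto
  then have "card (V - {v, w, a}) \<noteq> 0" using n by simp
  then have "V - {v, w, a} \<noteq> {}" by (metis card.empty)
  then interpret L: incidence "V - {v, w, a}" "av {v, w, a}" en by (rule sub_incidence)
  have "V - {v, w} \<noteq> {}" using V ne by blast
  then interpret K: incidence "V - {v, w}" "av {v, w}" en by (rule sub_incidence)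
  have VK: "V - {v, w} = insert a (V - {v, w, a})" using V ne by blast
  have EK: "av {v, w} = av {v, w, a} \<union> ?I" using av_triple ne by blast
  note K' = K.incidence_axioms[unfolded VK EK]
  have subE: "e1 \<in> E" "e2 \<in> E" "e3 \<in> E" "f1 \<in> E" "f2 \<in> E" "f3 \<in> E"
    using e(1) f(1) by (auto simp: inc_def)
  have "K.nconf a b1 b2 = K.nconf a d1 d2"
  proof -
    consider "card ?I = 0" | "card ?I = 1" | "card ?I = 2" using cI pos by linarith
    then show ?thesis
    proof cases
      case 1
      then have "?I = {}" by simp
      then have "av {v, w} = av {v, w, a}" using EK by blast
      then have "a \<notin> en e" if "e \<in> av {v, w}" for e using that by (auto simp: av_def)
      moreover obtain y where "y \<in> V - {v, w, a}" using L.neV by blast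
      ultimately show ?thesis using K.nconf_deg0[of a y] V ne by auto
    next
      case 2
      then obtain e where I: "?I = {e}" by (meson card_1_singletonE)
      then obtain y where y: "y \<in> V - {v, w, a}" "en e = {a, y}" using rest_end[of e a v w] by blast
      have eL: "e \<notin> av {v, w, a}" using y by (auto simp: av_def)
      \<comment> \<open>Otherwise three edges join \<open>w\<close> and \<open>a\<close>, too many
        for the degree of \<open>a\<close>, which also has an edge to \<open>v\<close> and the edge
        \<open>e\<close>.\<close>
      have "b1 \<noteq> a \<or> b2 \<noteq> a"
      proof (rule ccontr)
        assume "\<not> ?thesis"
        then have "{e1, e2, e3} \<subseteq> bt a w" using ene subE by (auto simp: bt_def)
        then have "card {e1, e2, e3} \<le> card (bt a w)" by (intro card_mono) auto
        then show False using e 2 cI pos by simp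
      qed
      moreover have "d1 \<noteq> a \<or> d2 \<noteq> a"
      proof (rule ccontr)
        assume "\<not> ?thesis"
        then have "{f1, f2, f3} \<subseteq> bt a v" using enf subE by (auto simp: bt_def)
        then have "card {f1, f2, f3} \<le> card (bt a v)" by (intro card_mono) auto
        then show False using f 2 cI pos by simp
      qed
      ultimately show ?thesis
        using L.nconf_deg1[OF _ eL y(2,1) _ _ _ K'[unfolded I]] zv(2-4) zw(2-4)
        unfolding VK EK I by auto
    next
      case 3
      then obtain e e' where I: "?I = {e, e'}" "e \<noteq> e'" by (meson card_2_iff)
      then obtain y where y: "y \<in> V - {v, w, a}" "en e = {a, y}" using rest_end[of e a v w] by blast
      obtain y' where y': "y' \<in> V - {v, w, a}" "en e' = {a, y'}" using rest_end[of e' a v w] I by blast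
      have eL: "e \<notin> av {v, w, a}" "e' \<notin> av {v, w, a}" using y y' by (auto simp: av_def)
      \<comment> \<open>Two edges from \<open>a\<close> to the rest leave only one to each of
        \<open>v\<close> and \<open>w\<close>, so the further neighbours of \<open>v\<close> and
        \<open>w\<close> differ from \<open>a\<close>.\<close>
      have c1: "card (bt a v) = 1" "card (bt a w) = 1" using cI pos 3 by linarith+
      have b: "b \<noteq> a" if "g \<in> {e2, e3}" "en g = {w, b}" for g b
      proof
        assume "b = a"
        then have "{e1, g} \<subseteq> bt a w" using that ene subE by (auto simp: bt_def)
        then have "card {e1, g} \<le> card (bt a w)" by (intro card_mono) auto
        then show False using that e c1 by auto
      qed
      have d: "b \<noteq> a" if "g \<in> {f2, f3}" "en g = {v, b}" for g b
      proof
        assume "b = a"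
        then have "{f1, g} \<subseteq> bt a v" using that enf subE by (auto simp: bt_def)
        then have "card {f1, g} \<le> card (bt a v)" by (intro card_mono) auto
        then show False using that f c1 by auto
      qed
      have bV: "b1 \<in> V - {v, w, a}" "b2 \<in> V - {v, w, a}" using zv(3,4) b ene by auto
      have dV: "d1 \<in> V - {v, w, a}" "d2 \<in> V - {v, w, a}" using zw(3,4) d enf by auto
      have cK: "card (av {v, w}) + 3 = 2 * card (V - {v, w})" using card_avoid2[OF V(1,2) ne(1) vw] n by simp
      have "card (av {v, w}) = card (av {v, w, a}) + 2"
        unfolding EK I using eL I by (subst card_Un_disjoint) auto
      moreover have "card (V - {v, w}) = card (V - {v, w, a}) + 1"
        unfolding VK using finV by simp
      ultimately have cL: "card (av {v, w, a}) + 3 = 2 * card (V - {v, w, a})" using cK by simp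
      have bal: "(\<Sum>e\<in>av {v, w, a}. dif \<chi> (en e)) = \<chi> y + \<chi> y' + (\<chi> b1 + \<chi> b2) + (\<chi> d1 + \<chi> d2)" for \<chi>
      proof -
        \<comment> \<open>With the potential set to 0 on the three removed vertices, an edge among
          them contributes nothing and an edge from them to the rest contributes
          \<open>\<chi>\<close> at its other end; \<open>handshake\<close> then gives the balance
          condition.\<close>
        define \<phi> where "\<phi> z = (if z \<in> {v, w, a} then 0 else \<chi> z)" for z
        obtain g0 where g0: "bt v w = {g0}" using vw by (meson card_1_singletonE)
        have "E = av {v, w} \<union> (inc w - bt v w) \<union> (inc v - bt w v) \<union> bt v w"
          using inc_Int[OF ne(1)] bt_commute[of v w] by (auto simp: av_def inc_def)
        then have Ed: "E = av {v, w, a} \<union> {e, e'} \<union> {e1, e2, e3} \<union> {f1, f2, f3} \<union> {g0}"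
          unfolding EK I(1) e(1) f(1) unfolding g0 .
        have d1: "av {v, w, a} \<inter> {e, e'} = {}" using eL by blast
        have d2: "(av {v, w, a} \<union> {e, e'}) \<inter> {e1, e2, e3} = {}"
          using ene unfolding I(1)[symmetric] EK[symmetric] by (auto simp: av_def)
        have d3: "(av {v, w, a} \<union> {e, e'} \<union> {e1, e2, e3}) \<inter> {f1, f2, f3} = {}"
        proof -
          have "(av {v, w} \<union> (inc w - bt v w)) \<inter> (inc v - bt w v) = {}"
            using inc_Int[OF ne(1)] bt_commute[of v w] by (auto simp: av_def inc_def)
          then show ?thesis unfolding EK I e(1) f(1) .
        qed
        have d4: "(av {v, w, a} \<union> {e, e'} \<union> {e1, e2, e3} \<union> {f1, f2, f3}) \<inter> {g0} = {}"
        proof -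
          have "(av {v, w} \<union> (inc w - bt v w) \<union> (inc v - bt w v)) \<inter> bt v w = {}"
            using bt_commute[of v w] by (auto simp: av_def bt_def)
          then show ?thesis unfolding EK I(1) e(1) f(1) unfolding g0 .
        qed
        have sE: "(\<Sum>g\<in>E. dif \<phi> (en g)) = (\<Sum>g\<in>av {v, w, a}. dif \<phi> (en g)) + (\<Sum>g\<in>{e, e'}. dif \<phi> (en g)) +
           (\<Sum>g\<in>{e1, e2, e3}. dif \<phi> (en g)) + (\<Sum>g\<in>{f1, f2, f3}. dif \<phi> (en g)) + (\<Sum>g\<in>{g0}. dif \<phi> (en g))"
        proof -
          let ?f = "\<lambda>g. dif \<phi> (en g)"
          have "sum ?f E = sum ?f (av {v, w, a} \<union> {e, e'} \<union> {e1, e2, e3} \<union> {f1, f2, f3} \<union> {g0})"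
            by (rule arg_cong[where f = "sum ?f", OF Ed])
          also have "\<dots> = sum ?f (av {v, w, a} \<union> {e, e'} \<union> {e1, e2, e3} \<union> {f1, f2, f3}) + sum ?f {g0}"
            by (rule sum.union_disjoint[OF _ _ d4]) simp_all
          also have "sum ?f (av {v, w, a} \<union> {e, e'} \<union> {e1, e2, e3} \<union> {f1, f2, f3}) =
              sum ?f (av {v, w, a} \<union> {e, e'} \<union> {e1, e2, e3}) + sum ?f {f1, f2, f3}"
            by (rule sum.union_disjoint[OF _ _ d3]) simp_all
          also have "sum ?f (av {v, w, a} \<union> {e, e'} \<union> {e1, e2, e3}) =
              sum ?f (av {v, w, a} \<union> {e, e'}) + sum ?f {e1, e2, e3}"
            by (rule sum.union_disjoint[OF _ _ d2]) simp_all
          also have "sum ?f (av {v, w, a} \<union> {e, e'}) = sum ?f (av {v, w, a}) + sum ?f {e, e'}"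
            by (rule sum.union_disjoint[OF _ _ d1]) simp_all
          finally show ?thesis .
        qed
        have "en g0 = {v, w}" using g0 by (auto simp: bt_def)
        then have "(\<Sum>g\<in>{g0}. dif \<phi> (en g)) = 0" by (simp add: \<phi>_def)
        moreover have "(\<Sum>g\<in>{e1, e2, e3}. dif \<phi> (en g)) = \<chi> b1 + \<chi> b2"
          using e bV by (simp add: ene \<phi>_def)
        moreover have "(\<Sum>g\<in>{f1, f2, f3}. dif \<phi> (en g)) = \<chi> d1 + \<chi> d2"
          using f dV by (simp add: enf \<phi>_def)
        moreover have "(\<Sum>g\<in>{e, e'}. dif \<phi> (en g)) = \<chi> y + \<chi> y'"
          using I(2) y y' by (simp add: \<phi>_def)
        moreover have "(\<Sum>g\<in>av {v, w, a}. dif \<phi> (en g)) = (\<Sum>g\<in>av {v, w, a}. dif \<chi> (en g))"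
          by (intro sum.cong refl dif_cong) (auto simp: av_def \<phi>_def)
        ultimately have "0 = (\<Sum>g\<in>av {v, w, a}. dif \<chi> (en g)) + (\<chi> y + \<chi> y') + (\<chi> b1 + \<chi> b2) + (\<chi> d1 + \<chi> d2)"
          using sE handshake[of \<phi>] by simp
        then have "(\<Sum>g\<in>av {v, w, a}. dif \<chi> (en g)) + (\<chi> y + \<chi> y' + (\<chi> b1 + \<chi> b2) + (\<chi> d1 + \<chi> d2)) = 0"
          by (simp only: add.assoc)
        then show ?thesis by (simp only: bit_add_eq_0_iff)
      qed
      have "K.nconf a b1 b2 = (\<Sum>T\<in>Pow (av {v, w, a}). L.cb {{y, y'}} T * L.cb {} (av {v, w, a} - T)) +
        (\<Sum>T\<in>Pow (av {v, w, a}). L.cb {} T * (L.cb {{y, y'}} (av {v, w, a} - T) * (1 + L.cb {{b1, b2}} (av {v, w, a} - T))))"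
        using L.nconf_deg2[OF _ eL I(2) y(2) y'(2) y(1) y'(1) bV cL K'[unfolded I(1)]] unfolding VK EK I(1) by simp
      moreover have "K.nconf a d1 d2 = (\<Sum>T\<in>Pow (av {v, w, a}). L.cb {{y, y'}} T * L.cb {} (av {v, w, a} - T)) +
        (\<Sum>T\<in>Pow (av {v, w, a}). L.cb {} T * (L.cb {{y, y'}} (av {v, w, a} - T) * (1 + L.cb {{d1, d2}} (av {v, w, a} - T))))"
        using L.nconf_deg2[OF _ eL I(2) y(2) y'(2) y(1) y'(1) dV cL K'[unfolded I(1)]] unfolding VK EK I(1) by simp
      ultimately show ?thesis using L.balanced_pairs[OF cL y(1) y'(1) bV dV bal] by simp
    qed
  qed
  then show ?thesis using zv(1) zw(1) unfolding wv_vw by simp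
qed

text \<open>If \<open>v\<close> and \<open>a\<close> are joined by one edge, removing
  \<open>a\<close> as a three-valent vertex leaves \<open>w\<close> with at most one edge, and the
  count is zero or that of partitions into two trees, which is even. Otherwise \<open>w\<close> and
  \<open>a\<close> have degree two after deletion of \<open>v\<close>, and
  \<open>zeros_chain\<close> applies.\<close>

lemma zeros_delete_multiple:
  assumes V: "v \<in> V" "w \<in> V" "a \<in> V" and vw: "2 \<le> card (bt v w)" and va: "bt v a \<noteq> {}" and wa: "bt w a \<noteq> {}"
    and n: "5 \<le> card V" and con: "conn V (en ` E)"
  shows "of_nat (zeros (V - {v}) (av {v}) en div 4) = (0 :: bit)"
proof -
  have "bt v w \<noteq> {}" using vw by auto
  then have ne: "v \<noteq> w" "a \<noteq> v" "a \<noteq> w" using bt_neq va wa by metis+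
  have card3: "card (V - {v, a, w}) = card V - 3" using V ne finV by (subst card_Diff_subset) auto
  then have "card (V - {v, a, w}) \<noteq> 0" using n by simp
  then have "V - {v, a, w} \<noteq> {}" by (metis card.empty)
  then interpret L: incidence "V - {v, a, w}" "av {v, a, w}" en by (rule sub_incidence)
  let ?I = "inc w - bt w v - bt w a"
  have cI: "card ?I + card (bt w v) + card (bt w a) = 4" using card_inc_minus[OF V(2) ne(2)[symmetric]] .
  have pos: "card (bt w a) \<ge> 1" "card (bt v a) \<ge> 1"
    using va wa by (auto simp: Suc_le_eq card_gt_0_iff)
  show ?thesis
  proof (cases "card (bt v a) = 1")
    case True
    obtain e1 where e1: "e1 \<in> bt a w" using wa bt_commute by blast
    then have "e1 \<in> inc a - bt v a" using ne by (auto simp: bt_def inc_def doubleton_eq_iff)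
    from star_edges[OF V(3) True this] obtain e2 e3 b1 b2 where
      e: "inc a - bt v a = {e1, e2, e3}" "e1 \<noteq> e2" "e1 \<noteq> e3" "e2 \<noteq> e3"
      and ene: "en e1 = {a, w}" "en e2 = {a, b1}" "en e3 = {a, b2}" using e1 by (auto simp: bt_def)
    note zv = zeros_delete[OF V(1,3) ne(2)[symmetric] True n e ene]
    have "V - {v, a} \<noteq> {}" using V ne by blast
    then interpret K: incidence "V - {v, a}" "av {v, a}" en by (rule sub_incidence)
    have VK: "V - {v, a} = insert w (V - {v, a, w})" using V ne by blast
    have EK: "av {v, a} = av {v, a, w} \<union> ?I" using av_triple[of v a w] ne by blast
    note K' = K.incidence_axioms[unfolded VK EK]
    have subE: "e1 \<in> E" "e2 \<in> E" "e3 \<in> E" using e(1) by (auto simp: inc_def)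
    have vw': "2 \<le> card (bt w v)" using vw bt_commute[of v w] by simp
    \<comment> \<open>Of the four edges at \<open>w\<close>, at least two go to \<open>v\<close> and
      one to \<open>a\<close>.\<close>
    consider "card ?I = 0" | "card ?I = 1" using cI pos vw' by linarith
    then have "K.nconf w b1 b2 = 0"
    proof cases
      case 1
      then have "?I = {}" by simp
      then have "av {v, a} = av {v, a, w}" using EK by blast
      then have "w \<notin> en e" if "e \<in> av {v, a}" for e using that by (auto simp: av_def)
      moreover obtain y where "y \<in> V - {v, a, w}" using L.neV by blast
      ultimately show ?thesis using K.nconf_deg0[of w y] V ne by auto
    next
      case 2
      then obtain e where I: "?I = {e}" by (meson card_1_singletonE)
      then obtain y where y: "y \<in> V - {v, a, w}" "en e = {w, y}" using rest_end[of e w v a] by blast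
      have eL: "e \<notin> av {v, a, w}" using y by (auto simp: av_def)
      have "b1 \<noteq> w \<or> b2 \<noteq> w"
      proof (rule ccontr)
        assume "\<not> ?thesis"
        then have "{e1, e2, e3} \<subseteq> bt w a" using ene subE by (auto simp: bt_def)
        then have "card {e1, e2, e3} \<le> card (bt w a)" by (intro card_mono) auto
        then show False using e 2 cI vw' by simp
      qed
      then have "K.nconf w b1 b2 = (\<Sum>T\<in>Pow (av {v, a, w}). L.cb {} T * L.cb {} (av {v, a, w} - T))"
        using L.nconf_deg1[OF _ eL y(2,1) _ _ _ K'[unfolded I]] zv(2-4)
        unfolding VK EK I by auto
      also have "\<dots> = 0"
      proof (rule L.sum_two_trees)
        have "card (av {v, a}) + 3 = 2 * card (V - {v, a})"
          using card_avoid2[OF V(1,3) ne(2)[symmetric] True] n by simp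
        moreover have "card (V - {v, a}) = card V - 2" using V ne finV by (subst card_Diff_subset) auto
        moreover have "card (av {v, a}) = card (av {v, a, w}) + 1" unfolding EK I using eL by simp
        ultimately have "card (av {v, a, w}) \<noteq> 0" using n by linarith
        then show "av {v, a, w} \<noteq> {}" by (metis card.empty)
      qed
      finally show ?thesis .
    qed
    then show ?thesis using zv(1) by simp
  next
    case False
    let ?A = "inc a - bt a v - bt a w"
    have cv: "card (inc v - bt v w - bt v a) + card (bt v w) + card (bt v a) = 4"
      using card_inc_minus[OF V(1) ne(3)[symmetric]] .
    have cA: "card ?A + card (bt a v) + card (bt a w) = 4" using card_inc_minus[OF V(3) ne(1)] .
    have va2: "2 \<le> card (bt v a)" using False pos by linarith
    note com = bt_commute[of a v] bt_commute[of w v] bt_commute[of a w]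
    \<comment> \<open>Now two edges join \<open>v\<close> to each of \<open>w\<close> and
      \<open>a\<close>, and there are no others at \<open>v\<close>.\<close>
    have two: "card (inc v - bt v w - bt v a) = 0" "card (bt v w) = 2" "card (bt v a) = 2" using cv vw va2 by linarith+
    then have incv: "inc v \<subseteq> bt v w \<union> bt v a" by simp blast
    have cIA: "card ?I + card (bt w a) = 2" "card ?A + card (bt w a) = 2" using cI cA two com by auto
    consider "card (bt w a) = 2" | "card (bt w a) = 1" using cIA pos by linarith
    then show ?thesis
    proof cases
      case 1
      then have "?I = {}" "?A = {}" using cIA by simp_all
      \<comment> \<open>All edges at \<open>v\<close>, \<open>w\<close>, \<open>a\<close> stay among
        these three vertices, which contradicts connectedness because there are others.\<close>
      then have closed: "inc v \<union> inc w \<union> inc a \<subseteq> bt v w \<union> bt v a \<union> bt w a" using incv com by blast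
      obtain y where y: "y \<in> V - {v, a, w}" using L.neV by blast
      let ?\<chi> = "\<lambda>z. of_bool (z \<in> {v, w, a}) :: bit"
      have "dif ?\<chi> s = 0" if s: "s \<in> en ` E" for s
      proof -
        obtain g where g: "g \<in> E" "s = en g" using s by blast
        show ?thesis
        proof (cases "en g \<inter> {v, w, a} = {}")
          case True
          then show ?thesis unfolding g(2) dif_eq_0_iff by auto
        next
          case False
          then have "g \<in> inc v \<union> inc w \<union> inc a" using g by (auto simp: inc_def)
          then have "en g \<subseteq> {v, w, a}" using closed by (auto simp: bt_def)
          then show ?thesis unfolding g(2) dif_eq_0_iff by auto
        qed
      qed
      then have "?\<chi> v = ?\<chi> y" using connD[OF con, of ?\<chi> v y] V y by blast
      then show ?thesis using y by simp
    next
      case 2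
      \<comment> \<open>After deletion of \<open>v\<close> the edges at \<open>w\<close> and
        \<open>a\<close> form the path \<open>p\<close>, \<open>q\<close>, \<open>r\<close>.\<close>
      then have "card ?I = 1" "card ?A = 1" using cIA by linarith+
      then obtain p r where I: "?I = {p}" and A: "?A = {r}" by (meson card_1_singletonE)
      obtain q where q: "bt w a = {q}" using 2 by (meson card_1_singletonE)
      obtain z' where z': "z' \<in> V - {v, a, w}" "en p = {w, z'}" using rest_end[of p w v a] I by blast
      obtain z where z: "z \<in> V - {v, w, a}" "en r = {a, z}" using rest_end[of r a v w] A by blast
      have enq: "en q = {w, a}" using q by (auto simp: bt_def)
      have "av {v} = av {v, a, w} \<union> (inc w - bt w v) \<union> (inc a - bt a v)"
        using inc_Int[of w v] inc_Int[of a v] ne by (auto simp: av_def inc_def)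
      moreover have "inc w - bt w v = ?I \<union> bt w a"
        using bt_subset[of w a] bt_disjoint[of v a w] ne by blast
      moreover have "inc a - bt a v = ?A \<union> bt w a"
        using bt_subset[of a w] bt_disjoint[of v w a] ne com by blast
      ultimately have "av {v} = av {v, a, w} \<union> (?I \<union> bt w a) \<union> (?A \<union> bt w a)" by (simp only:)
      then have "av {v} = av {v, a, w} \<union> ({p} \<union> {q}) \<union> ({r} \<union> {q})" unfolding I A unfolding q .
      then have Ev: "av {v} = av {v, a, w} \<union> {p, q, r}" by (simp add: insert_commute)
      have Vv: "V - {v} = insert w (insert a (V - {v, a, w}))" using V ne by blast
      show ?thesis unfolding Ev Vv
      proof (rule L.zeros_chain)
        show "w \<notin> insert a (V - {v, a, w})" "a \<notin> V - {v, a, w}" using ne by auto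
        show "z \<in> V - {v, a, w}" "z' \<in> V - {v, a, w}" using z z' by auto
        show "en p = {w, z'}" "en q = {w, a}" "en r = {a, z}" by fact+
        show "p \<noteq> q" "p \<noteq> r" "q \<noteq> r" using z z' enq ne by (auto simp: doubleton_eq_iff)
        show "p \<notin> av {v, a, w}" "q \<notin> av {v, a, w}" "r \<notin> av {v, a, w}"
          using z z' enq by (auto simp: av_def)
        show "2 \<le> card (V - {v, a, w})" using card3 n by simp
      qed
    qed
  qed
qed

text \<open>The two remaining edges are parallel, so there are four points. The point where only
  \<open>e\<close> vanishes is not a zero, as \<open>{e}\<close> is the only tree containing
  \<open>e\<close>; hence there are fewer than four zeros.\<close>

lemma zeros_delete_three:
  assumes "v \<in> V" "card V = 3"
  shows "zeros (V - {v}) (av {v}) en div 4 = 0"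
proof -
  let ?t = "trees (V - {v}) (av {v}) en"
  have "E = av {v} \<union> inc v" "av {v} \<inter> inc v = {}" by (auto simp: av_def inc_def)
  then have "card E = card (av {v}) + card (inc v)" by (metis card_Un_disjoint fin(1,3))
  then have cE: "card (av {v}) = 2" using card_edges card_inc assms by simp
  have cV: "card (V - {v}) = 2" using assms finV by simp
  obtain e where e: "e \<in> av {v}" using cE by fastforce
  then have "en e \<subseteq> V - {v}" "card (en e) = 2" using enV en2 by (auto simp: av_def)
  then have ene: "en e = V - {v}" using cV finV by (metis card_subset_eq finite_Diff)
  have con: "conn (V - {v}) {en e}"
    unfolding ene conn_def
  proof (intro allI impI)
    fix \<psi> :: "'v \<Rightarrow> bit" assume "\<forall>r\<in>{V - {v}}. dif \<psi> r = 0"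
    then have "dif \<psi> (V - {v}) = 0" by simp
    then show "\<forall>a\<in>V - {v}. \<forall>b\<in>V - {v}. \<psi> a = \<psi> b" by (simp only: dif_eq_0_iff)
  qed
  have "?t {e} = (\<Sum>D\<in>Pow (av {v}). if D = {e} then 1 else 0)"
    unfolding trees_def
  proof (rule sum.cong[OF refl])
    fix D
    have "{e} \<subseteq> D \<and> card D + 1 = card (V - {v}) \<and> conn (V - {v}) (en ` D) \<longleftrightarrow> D = {e}"
      using cV con by (auto simp: card_1_singleton_iff)
    then show "of_bool ({e} \<subseteq> D \<and> card D + 1 = card (V - {v}) \<and> conn (V - {v}) (en ` D)) = (if D = {e} then 1 else 0 :: bit)"
      by simp
  qed
  also have "\<dots> = 1" using e by simp
  finally have te: "?t {e} = 1" .
  have "zeros (V - {v}) (av {v}) en < (\<Sum>Z\<in>Pow (av {v}). 1)"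
    unfolding zeros_def by (rule sum_strict_mono_ex1) (use te e in \<open>auto intro!: bexI[of _ "{e}"]\<close>)
  also have "\<dots> = 4" using cE by (simp add: card_Pow)
  finally show ?thesis by simp
qed

text \<open>On four vertices the degree equations force disjoint pairs of vertices to be joined by
  equally many edges. So if \<open>a\<close> is a common neighbour of \<open>v\<close> and
  \<open>w\<close>, the fourth vertex is one as well.\<close>

lemma card_verts_neq_4:
  assumes V: "v \<in> V" "w \<in> V" "a \<in> V" and ne: "v \<noteq> w" "a \<noteq> v" "a \<noteq> w" and va: "bt v a \<noteq> {}" and wa: "bt w a \<noteq> {}"
    and only: "\<And>b. b \<in> V \<Longrightarrow> b \<noteq> a \<Longrightarrow> bt v b = {} \<or> bt w b = {}"
  shows "card V \<noteq> 4"
proof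
  assume c: "card V = 4"
  have "card (V - {v, w, a}) = 1" using V ne finV c by (subst card_Diff_subset) auto
  then obtain b where b: "V - {v, w, a} = {b}" by (meson card_1_singletonE)
  then have bne: "b \<noteq> v" "b \<noteq> w" "b \<noteq> a" and bV: "b \<in> V" by auto
  have Veq: "V = {v, w, a, b}" using b V by blast
  have s: "V - {v} = {w, a, b}" "V - {w} = {v, a, b}" "V - {a} = {v, w, b}" "V - {b} = {v, w, a}"
    using Veq ne bne by auto
  have "4 = card (bt v w) + card (bt v a) + card (bt v b)"
    using card_inc_eq_sum[OF V(1)] ne bne unfolding s by simp
  moreover have "4 = card (bt v w) + card (bt w a) + card (bt w b)"
    using card_inc_eq_sum[OF V(2)] ne bne bt_commute[of w v] unfolding s by simp
  moreover have "4 = card (bt v a) + card (bt w a) + card (bt a b)"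
    using card_inc_eq_sum[OF V(3)] ne bne bt_commute[of a v] bt_commute[of a w] unfolding s by simp
  moreover have "4 = card (bt v b) + card (bt w b) + card (bt a b)"
    using card_inc_eq_sum[OF bV] ne bne bt_commute[of b] unfolding s by simp
  moreover have "card (bt v a) \<noteq> 0" "card (bt w a) \<noteq> 0" using va wa by auto
  moreover have "card (bt v b) = 0 \<or> card (bt w b) = 0" using only[OF bV bne(3)] by auto
  ultimately show False by linarith
qed

end

theorem theorem4p11:
  fixes G :: "('v, 'e) mgraph" and v w :: 'v
  assumes "wf_mgraph G"
    and "connected_graph G"
    and "regular 4 G"
    and "v \<in> verts G" and "w \<in> verts G"
    and "adjacent G v w"
    and "card (neighbours G v \<inter> neighbours G w) = 1"
  shows "c2 2 (delete_vertex G v) = c2 2 (delete_vertex G w)"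
proof -
  let ?V = "verts G" and ?E = "edges G" and ?en = "ends G"
  interpret four_regular ?V ?E ?en
    using assms(1,3,4) by unfold_locales (auto simp: wf_mgraph_def regular_def degree_def)
  obtain a where a: "neighbours G v \<inter> neighbours G w = {a}" using assms(7) by (meson card_1_singletonE)
  then have aN: "a \<in> neighbours G v" "a \<in> neighbours G w" by blast+
  have va: "bt v a \<noteq> {}" and wa: "bt w a \<noteq> {}" and vw: "bt v w \<noteq> {}" and aV: "a \<in> ?V"
    using aN assms(6) by (auto simp: neighbours_def adjacent_def bt_def)
  have ne: "v \<noteq> w" "a \<noteq> v" "a \<noteq> w" using va wa vw bt_neq by metis+
  have only: "bt v b = {} \<or> bt w b = {}" if "b \<in> ?V" "b \<noteq> a" for b
  proof (rule ccontr)
    assume "\<not> ?thesis"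
    then have "b \<in> neighbours G v \<inter> neighbours G w"
      using that by (auto simp: neighbours_def adjacent_def bt_def)
    then show False using a that by blast
  qed
  have con: "conn ?V (?en ` ?E)"
    using assms(2) connected_graph_iff_conn[of G] en_pair by blast
  have "card {v, w, a} \<le> card ?V" using assms(4,5) aV finV by (intro card_mono) auto
  then have "3 \<le> card ?V" using ne by simp
  \<comment> \<open>Three vertices are treated by hand; from five on, enough vertices remain after
    deleting two.\<close>
  then consider "card ?V = 3" | "5 \<le> card ?V"
    using card_verts_neq_4[OF assms(4,5) aV ne va wa only] by linarith
  then have "(of_nat (zeros (?V - {v}) (av {v}) ?en div 4) :: bit) = of_nat (zeros (?V - {w}) (av {w}) ?en div 4)"
  proof cases
    case 1
    then show ?thesis using zeros_delete_three assms(4,5) by simp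
  next
    case 2
    show ?thesis
    proof (cases "card (bt v w) = 1")
      case True
      then show ?thesis using zeros_delete_simple[OF assms(4,5) aV _ va wa 2] by blast
    next
      case False
      then have vw2: "2 \<le> card (bt v w)" "2 \<le> card (bt w v)"
        using vw bt_commute[of v w] by (auto simp: Suc_le_eq card_gt_0_iff nat_less_le eval_nat_numeral)
      \<comment> \<open>The multiple edge is symmetric in \<open>v\<close> and \<open>w\<close>, so
        both sides are 0.\<close>
      show ?thesis
        using zeros_delete_multiple[OF assms(4,5) aV vw2(1) va wa 2 con]
          zeros_delete_multiple[OF assms(5,4) aV vw2(2) wa va 2 con] by simp
    qed
  qed
  moreover have "verts (delete_vertex G x) = ?V - {x}" "edges (delete_vertex G x) = av {x}"
    "ends (delete_vertex G x) = ?en" for x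
    by (auto simp: delete_vertex_def av_def)
  moreover have "wf_mgraph (delete_vertex G x)" for x
    using assms(1) by (auto simp: wf_mgraph_def delete_vertex_def)
  moreover have "?V - {v} \<noteq> {}" "?V - {w} \<noteq> {}" using assms(4,5) ne by blast+
  ultimately show ?thesis by (intro c2_eqI) simp_all
qed

end
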